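(* Let $T$ be a regular positive initial tree containing no conjunctions which is not GH2, not coordinated, not Henkin and not signalling. Then $T$ can be reduced to a first-order tree (a tree all of whose slash sets are empty), and thus $T$ is in FO.
   Context: IF logic: formulas from (negated) atoms by $\land,\lor$ and slashed quantifiers $(\exists v/V),(\forall v/V)$, team semantics, $M\models\varphi$ iff $M,\{\emptyset\}\models\varphi$. Synctactical trees: finite trees of occurrences of atoms (leaves), negations/quantifiers (at most one successor), $\land,\lor$ (at most two successors); positive initial: no atoms or negations; $\hat T$: attach gap leaves (2 minus successors to each connective, one to each quantifier with no successor); paths: maximal linear suborders of $\hat T$; regular: no variable both free and bound and no $(Qv/V)$ in scope of a same-kind $(Qv/W)$. Completing function $e$: regular IF formula for each path; weak: quantifier-free; sentential: $FV(e(P))\subseteq Bound(P)$; $\hat e(T)$: place $e(P)$ at each path's gap. $C(T)$ is the set of classes of finite models of $\hat e(T)$, $e$ weak sentential; "$T$ reduces to $T'$" is meant in the sense that $C(T)\subseteq C(T')$. $T$ is in FO if every member of $C(T)$ is first-order definable. $(Qy/Y)$ depends on $(Q'x/X)$ if it lies in its scope and $x\notin Y$. Henkin path: contains $(\forall x/X),(\exists y/Y),(\forall z/Z),(\exists w/W)$ with $\exists y$ depending on $\forall x$ but not on $\forall z,\exists w$, and $\exists w$ depending on $\forall z$ but not on $\forall x,\exists y$. Signalling path: $(\forall x/X),(\exists y/Y),(\exists z/Z)$ with $\exists y$ depending on $\forall x$, $\exists z$ on $\exists y$ but not on $\forall x$. A tree is Henkin/signalling if some path is. A generalized Henkin pattern: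 $\forall x,\forall y,(\exists u/U),(\exists v/V)$ and a binary connective $\circ$ with both existentials in the scope of $\forall x$, $u$ depending on $x$ but not on $y,v$, $v$ depending on $y$ but not on $x,u$, $\circ$ in the scope of $\forall x$ with the existentials in different immediate subtrees of $\circ$; it is GH2 if $\forall y$ lies above $\circ$. A tree is GH2 if it contains such a GH2 pattern. Coordinated: contains $(\forall x/X)$, $\lor$, $(\forall y/Y)$, $(\forall z/Z)$, $(\exists u/U)$, $(\exists w/W)$ with $\lor$ in the scope of $\forall x$, both existentials in the scope of $\lor$, $(\exists u/U)$ depending on $y$ but not on $x,z,w$, and $(\exists w/W)$ depending on $z$ but not on $x,y,u$.
   Formalization: "Regular" is taken in the standard sense that no quantifier on v, of either kind, lies in the scope of any quantifier on v; if only quantifiers of the same kind were excluded, the claim would fail (an inner ∃x can overwrite an outer ∀x and hide a Henkin dependence). *)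

theory Defs
  imports Main "HOL-Library.FSet" "HOL-Library.Sublist"
begin

section \<open>Syntax\<close>

text \<open>A symbol is a name together with an arity; constants are function symbols of arity 0.\<close>

record signature =
  rel_syms :: "(nat \<times> nat) set"
  fun_syms :: "(nat \<times> nat) set"

datatype trm = Var nat | Fun nat "trm list"

datatype atom = Eq trm trm | Rel nat "trm list"

datatype literal = PosLit atom | NegLit atom

datatype quantifier = Forall | Exists

datatype connective = And | Or

text \<open>
  \<open>Quant Q v V t\<close> is the slashed quantifier \<open>(Qv/V)\<close> in front of \<open>t\<close>. The type is used twice:
  IF formulas are the trees whose leaves are literals; a positive initial tree T (no atoms, no
  negations) is given by its gapped version T-hat, in which every missing successor
  of a node of T is a gap leaf, here \<open>Leaf ()\<close>. (\<open>Leaf ()\<close> alone is the empty tree.)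
\<close>

datatype 'l tree =
    Leaf 'l
  | Quant quantifier nat "nat fset" "'l tree"
  | Conn connective "'l tree" "'l tree"

type_synonym if_formula = "literal tree"
type_synonym pi_tree = "unit tree"

primrec trm_vars :: "trm \<Rightarrow> nat set" where
  "trm_vars (Var x) = {x}"
| "trm_vars (Fun f ts) = \<Union> (set (map trm_vars ts))"

primrec atom_vars :: "atom \<Rightarrow> nat set" where
  "atom_vars (Eq t u) = trm_vars t \<union> trm_vars u"
| "atom_vars (Rel r ts) = \<Union> (set (map trm_vars ts))"

primrec literal_vars :: "literal \<Rightarrow> nat set" where
  "literal_vars (PosLit a) = atom_vars a"
| "literal_vars (NegLit a) = atom_vars a"

primrec trm_over :: "signature \<Rightarrow> trm \<Rightarrow> bool" where
  "trm_over \<sigma> (Var x) = True"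
| "trm_over \<sigma> (Fun f ts) = ((f, length ts) \<in> fun_syms \<sigma> \<and> list_all (trm_over \<sigma>) ts)"

primrec atom_over :: "signature \<Rightarrow> atom \<Rightarrow> bool" where
  "atom_over \<sigma> (Eq t u) = (trm_over \<sigma> t \<and> trm_over \<sigma> u)"
| "atom_over \<sigma> (Rel r ts) = ((r, length ts) \<in> rel_syms \<sigma> \<and> list_all (trm_over \<sigma>) ts)"

primrec literal_over :: "signature \<Rightarrow> literal \<Rightarrow> bool" where
  "literal_over \<sigma> (PosLit a) = atom_over \<sigma> a"
| "literal_over \<sigma> (NegLit a) = atom_over \<sigma> a"

definition formula_over :: "signature \<Rightarrow> if_formula \<Rightarrow> bool" where
  "formula_over \<sigma> \<phi> \<longleftrightarrow> (\<forall>l \<in> set_tree \<phi>. literal_over \<sigma> l)"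

text \<open>Variables in a slash set count as free occurrences, as usual in IF logic. The parameter
  gives the variables of a leaf.\<close>

primrec free_vars :: "('l \<Rightarrow> nat set) \<Rightarrow> 'l tree \<Rightarrow> nat set" where
  "free_vars lv (Leaf l) = lv l"
| "free_vars lv (Quant Q v V t) = fset V \<union> (free_vars lv t - {v})"
| "free_vars lv (Conn c l r) = free_vars lv l \<union> free_vars lv r"

primrec bound_vars :: "'l tree \<Rightarrow> nat set" where
  "bound_vars (Leaf l) = {}"
| "bound_vars (Quant Q v V t) = insert v (bound_vars t)"
| "bound_vars (Conn c l r) = bound_vars l \<union> bound_vars r"

text \<open>No quantifier on \<open>v\<close>, universal or existential, lies in the scope of a quantifier on \<open>v\<close>.\<close>

primrec no_requantification :: "'l tree \<Rightarrow> bool" where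
  "no_requantification (Leaf l) = True"
| "no_requantification (Quant Q v V t) = (v \<notin> bound_vars t \<and> no_requantification t)"
| "no_requantification (Conn c l r) = (no_requantification l \<and> no_requantification r)"

definition regular_formula :: "if_formula \<Rightarrow> bool" where
  "regular_formula \<phi> \<longleftrightarrow> free_vars literal_vars \<phi> \<inter> bound_vars \<phi> = {} \<and> no_requantification \<phi>"

definition regular_tree :: "pi_tree \<Rightarrow> bool" where
  "regular_tree T \<longleftrightarrow> free_vars (\<lambda>_. {}) T \<inter> bound_vars T = {} \<and> no_requantification T"

primrec quantifier_free :: "'l tree \<Rightarrow> bool" where
  "quantifier_free (Leaf l) = True"
| "quantifier_free (Quant Q v V t) = False"
| "quantifier_free (Conn c l r) = (quantifier_free l \<and> quantifier_free r)"

primrec no_conjunctions :: "'l tree \<Rightarrow> bool" where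
  "no_conjunctions (Leaf l) = True"
| "no_conjunctions (Quant Q v V t) = no_conjunctions t"
| "no_conjunctions (Conn c l r) = (c \<noteq> And \<and> no_conjunctions l \<and> no_conjunctions r)"

primrec first_order_tree :: "'l tree \<Rightarrow> bool" where
  "first_order_tree (Leaf l) = True"
| "first_order_tree (Quant Q v V t) = (V = {||} \<and> first_order_tree t)"
| "first_order_tree (Conn c l r) = (first_order_tree l \<and> first_order_tree r)"


section \<open>Team semantics\<close>

text \<open>The values of \<open>rel_int\<close> and \<open>fun_int\<close> at symbols outside \<open>sig\<close> are irrelevant.\<close>

record 'a struc =
  sig :: signature
  carrier :: "'a set"
  rel_int :: "nat \<Rightarrow> 'a list \<Rightarrow> bool"
  fun_int :: "nat \<Rightarrow> 'a list \<Rightarrow> 'a"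

definition finite_structure :: "signature \<Rightarrow> 'a struc \<Rightarrow> bool" where
  "finite_structure \<sigma> M \<longleftrightarrow> sig M = \<sigma> \<and> finite (carrier M) \<and> carrier M \<noteq> {} \<and>
     (\<forall>(f, n) \<in> fun_syms \<sigma>. \<forall>as. length as = n \<and> set as \<subseteq> carrier M \<longrightarrow> fun_int M f as \<in> carrier M)"

type_synonym 'a assignment = "nat \<rightharpoonup> 'a"

primrec trm_val :: "'a struc \<Rightarrow> 'a assignment \<Rightarrow> trm \<Rightarrow> 'a" where
  "trm_val M s (Var x) = the (s x)"
| "trm_val M s (Fun f ts) = fun_int M f (map (trm_val M s) ts)"

primrec atom_holds :: "'a struc \<Rightarrow> 'a assignment \<Rightarrow> atom \<Rightarrow> bool" where
  "atom_holds M s (Eq t u) = (trm_val M s t = trm_val M s u)"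
| "atom_holds M s (Rel r ts) = rel_int M r (map (trm_val M s) ts)"

primrec literal_holds :: "'a struc \<Rightarrow> 'a assignment \<Rightarrow> literal \<Rightarrow> bool" where
  "literal_holds M s (PosLit a) = atom_holds M s a"
| "literal_holds M s (NegLit a) = (\<not> atom_holds M s a)"

text \<open>All assignments of a team have the same domain, so agreement at every variable outside \<open>V\<close>
  is agreement on the domain minus \<open>V\<close>.\<close>

definition uniform :: "nat set \<Rightarrow> 'a assignment set \<Rightarrow> ('a assignment \<Rightarrow> 'a) \<Rightarrow> bool" where
  "uniform V X F \<longleftrightarrow> (\<forall>s \<in> X. \<forall>s' \<in> X. (\<forall>x. x \<notin> V \<longrightarrow> s x = s' x) \<longrightarrow> F s = F s')"

primrec team_sat :: "'a struc \<Rightarrow> if_formula \<Rightarrow> 'a assignment set \<Rightarrow> bool" where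
  "team_sat M (Leaf l) X = (\<forall>s \<in> X. literal_holds M s l)"
| "team_sat M (Quant Q v V \<phi>) X =
     (case Q of
        Forall \<Rightarrow> team_sat M \<phi> {s(v \<mapsto> a) | s a. s \<in> X \<and> a \<in> carrier M}
      | Exists \<Rightarrow> (\<exists>F. (\<forall>s \<in> X. F s \<in> carrier M) \<and> uniform (fset V) X F \<and>
                       team_sat M \<phi> {s(v \<mapsto> F s) | s. s \<in> X}))"
| "team_sat M (Conn c \<phi> \<psi>) X =
     (case c of
        And \<Rightarrow> team_sat M \<phi> X \<and> team_sat M \<psi> X
      | Or \<Rightarrow> (\<exists>Y Z. X = Y \<union> Z \<and> team_sat M \<phi> Y \<and> team_sat M \<psi> Z))"

definition models :: "'a struc \<Rightarrow> if_formula \<Rightarrow> bool" where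
  "models M \<phi> \<longleftrightarrow> team_sat M \<phi> {Map.empty}"


section \<open>First-order definability\<close>

datatype fo =
    FOAtom atom
  | FONot fo
  | FOAnd fo fo
  | FOOr fo fo
  | FOAll nat fo
  | FOEx nat fo

primrec fo_over :: "signature \<Rightarrow> fo \<Rightarrow> bool" where
  "fo_over \<sigma> (FOAtom a) = atom_over \<sigma> a"
| "fo_over \<sigma> (FONot \<phi>) = fo_over \<sigma> \<phi>"
| "fo_over \<sigma> (FOAnd \<phi> \<psi>) = (fo_over \<sigma> \<phi> \<and> fo_over \<sigma> \<psi>)"
| "fo_over \<sigma> (FOOr \<phi> \<psi>) = (fo_over \<sigma> \<phi> \<and> fo_over \<sigma> \<psi>)"
| "fo_over \<sigma> (FOAll v \<phi>) = fo_over \<sigma> \<phi>"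
| "fo_over \<sigma> (FOEx v \<phi>) = fo_over \<sigma> \<phi>"

primrec fo_free :: "fo \<Rightarrow> nat set" where
  "fo_free (FOAtom a) = atom_vars a"
| "fo_free (FONot \<phi>) = fo_free \<phi>"
| "fo_free (FOAnd \<phi> \<psi>) = fo_free \<phi> \<union> fo_free \<psi>"
| "fo_free (FOOr \<phi> \<psi>) = fo_free \<phi> \<union> fo_free \<psi>"
| "fo_free (FOAll v \<phi>) = fo_free \<phi> - {v}"
| "fo_free (FOEx v \<phi>) = fo_free \<phi> - {v}"

primrec fo_sat :: "'a struc \<Rightarrow> 'a assignment \<Rightarrow> fo \<Rightarrow> bool" where
  "fo_sat M s (FOAtom a) = atom_holds M s a"
| "fo_sat M s (FONot \<phi>) = (\<not> fo_sat M s \<phi>)"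
| "fo_sat M s (FOAnd \<phi> \<psi>) = (fo_sat M s \<phi> \<and> fo_sat M s \<psi>)"
| "fo_sat M s (FOOr \<phi> \<psi>) = (fo_sat M s \<phi> \<or> fo_sat M s \<psi>)"
| "fo_sat M s (FOAll v \<phi>) = (\<forall>a \<in> carrier M. fo_sat M (s(v \<mapsto> a)) \<phi>)"
| "fo_sat M s (FOEx v \<phi>) = (\<exists>a \<in> carrier M. fo_sat M (s(v \<mapsto> a)) \<phi>)"

text \<open>Classes of finite structures are isomorphism closed, and every finite structure is isomorphic
  to one whose carrier is a set of natural numbers; so a class is given by its members over \<open>nat\<close>.\<close>

definition fo_definable :: "nat struc set \<Rightarrow> bool" where
  "fo_definable K \<longleftrightarrow> (\<exists>\<sigma> \<phi>. fo_over \<sigma> \<phi> \<and> fo_free \<phi> = {} \<and>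
     K = {M. finite_structure \<sigma> M \<and> fo_sat M Map.empty \<phi>})"


section \<open>Completions of a tree\<close>

text \<open>
  Occurrences of nodes are addressed by the lists of branching choices leading to them from the
  root. Thus \<open>q\<close> lies in the scope of \<open>p\<close> iff \<open>p\<close> is a strict prefix of \<open>q\<close>.
\<close>

fun subtree_at :: "'l tree \<Rightarrow> nat list \<Rightarrow> 'l tree option" where
  "subtree_at t [] = Some t"
| "subtree_at (Quant Q v V t) (i # p) = (if i = 0 then subtree_at t p else None)"
| "subtree_at (Conn c l r) (i # p) =
     (if i = 0 then subtree_at l p else if i = 1 then subtree_at r p else None)"
| "subtree_at (Leaf l) (i # p) = None"

definition quant_at :: "'l tree \<Rightarrow> nat list \<Rightarrow> quantifier \<Rightarrow> nat \<Rightarrow> nat fset \<Rightarrow> bool" where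
  "quant_at T p Q v V \<longleftrightarrow> (\<exists>t. subtree_at T p = Some (Quant Q v V t))"

definition conn_at :: "'l tree \<Rightarrow> nat list \<Rightarrow> connective \<Rightarrow> bool" where
  "conn_at T p c \<longleftrightarrow> (\<exists>l r. subtree_at T p = Some (Conn c l r))"

text \<open>A maximal linear suborder of T-hat consists of the addresses that are prefixes of
  the address \<open>g\<close> of a gap; paths are represented by this \<open>g\<close>.\<close>

definition is_path :: "pi_tree \<Rightarrow> nat list \<Rightarrow> bool" where
  "is_path T g \<longleftrightarrow> subtree_at T g = Some (Leaf ())"

definition path_bound :: "pi_tree \<Rightarrow> nat list \<Rightarrow> nat set" where
  "path_bound T g = {v. \<exists>p Q V. prefix p g \<and> quant_at T p Q v V}"

definition completing :: "signature \<Rightarrow> pi_tree \<Rightarrow> (nat list \<Rightarrow> if_formula) \<Rightarrow> bool" where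
  "completing \<sigma> T e \<longleftrightarrow> (\<forall>g. is_path T g \<longrightarrow> regular_formula (e g) \<and> formula_over \<sigma> (e g))"

definition weak :: "pi_tree \<Rightarrow> (nat list \<Rightarrow> if_formula) \<Rightarrow> bool" where
  "weak T e \<longleftrightarrow> (\<forall>g. is_path T g \<longrightarrow> quantifier_free (e g))"

definition sentential :: "pi_tree \<Rightarrow> (nat list \<Rightarrow> if_formula) \<Rightarrow> bool" where
  "sentential T e \<longleftrightarrow> (\<forall>g. is_path T g \<longrightarrow> free_vars literal_vars (e g) \<subseteq> path_bound T g)"

primrec completion :: "pi_tree \<Rightarrow> (nat list \<Rightarrow> if_formula) \<Rightarrow> if_formula" where
  "completion (Leaf _) e = e []"
| "completion (Quant Q v V t) e = Quant Q v V (completion t (\<lambda>p. e (0 # p)))"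
| "completion (Conn c l r) e =
     Conn c (completion l (\<lambda>p. e (0 # p))) (completion r (\<lambda>p. e (1 # p)))"

text \<open>The set \<open>C(T)\<close>.\<close>

definition model_classes :: "pi_tree \<Rightarrow> nat struc set set" where
  "model_classes T = {K. \<exists>\<sigma> e. completing \<sigma> T e \<and> weak T e \<and> sentential T e \<and>
     K = {M. finite_structure \<sigma> M \<and> models M (completion T e)}}"

definition reduces_to :: "pi_tree \<Rightarrow> pi_tree \<Rightarrow> bool" where
  "reduces_to T T' \<longleftrightarrow> model_classes T \<subseteq> model_classes T'"

definition in_FO :: "pi_tree \<Rightarrow> bool" where
  "in_FO T \<longleftrightarrow> (\<forall>K \<in> model_classes T. fo_definable K)"


section \<open>Dependence patterns\<close>

definition forall_at :: "pi_tree \<Rightarrow> nat list \<Rightarrow> bool" where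
  "forall_at T p \<longleftrightarrow> (\<exists>v V. quant_at T p Forall v V)"

definition exists_at :: "pi_tree \<Rightarrow> nat list \<Rightarrow> bool" where
  "exists_at T p \<longleftrightarrow> (\<exists>v V. quant_at T p Exists v V)"

text \<open>\<open>depends T p q\<close>: the quantifier at \<open>p\<close> depends on the quantifier at \<open>q\<close>.\<close>

definition depends :: "pi_tree \<Rightarrow> nat list \<Rightarrow> nat list \<Rightarrow> bool" where
  "depends T p q \<longleftrightarrow> strict_prefix q p \<and>
     (\<exists>Q y Y Q' x X. quant_at T p Q y Y \<and> quant_at T q Q' x X \<and> x |\<notin>| Y)"

definition henkin_path :: "pi_tree \<Rightarrow> nat list \<Rightarrow> bool" where
  "henkin_path T g \<longleftrightarrow> is_path T g \<and>
     (\<exists>x y z w. prefix x g \<and> prefix y g \<and> prefix z g \<and> prefix w g \<and>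
        forall_at T x \<and> exists_at T y \<and> forall_at T z \<and> exists_at T w \<and>
        depends T y x \<and> \<not> depends T y z \<and> \<not> depends T y w \<and>
        depends T w z \<and> \<not> depends T w x \<and> \<not> depends T w y)"

definition signalling_path :: "pi_tree \<Rightarrow> nat list \<Rightarrow> bool" where
  "signalling_path T g \<longleftrightarrow> is_path T g \<and>
     (\<exists>x y z. prefix x g \<and> prefix y g \<and> prefix z g \<and>
        forall_at T x \<and> exists_at T y \<and> exists_at T z \<and>
        depends T y x \<and> depends T z y \<and> \<not> depends T z x)"

definition henkin :: "pi_tree \<Rightarrow> bool" where
  "henkin T \<longleftrightarrow> (\<exists>g. henkin_path T g)"

definition signalling :: "pi_tree \<Rightarrow> bool" where
  "signalling T \<longleftrightarrow> (\<exists>g. signalling_path T g)"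

text \<open>\<open>x, y, u, v, b\<close> are the addresses of the two universal quantifiers, the two existential ones
  and the binary connective.\<close>

definition gen_henkin_pattern ::
  "pi_tree \<Rightarrow> nat list \<Rightarrow> nat list \<Rightarrow> nat list \<Rightarrow> nat list \<Rightarrow> nat list \<Rightarrow> bool" where
  "gen_henkin_pattern T x y u v b \<longleftrightarrow>
     forall_at T x \<and> forall_at T y \<and> exists_at T u \<and> exists_at T v \<and> (\<exists>c. conn_at T b c) \<and>
     strict_prefix x u \<and> strict_prefix x v \<and>
     depends T u x \<and> \<not> depends T u y \<and> \<not> depends T u v \<and>
     depends T v y \<and> \<not> depends T v x \<and> \<not> depends T v u \<and>
     strict_prefix x b \<and>
     (\<exists>i j. i \<noteq> j \<and> prefix (b @ [i]) u \<and> prefix (b @ [j]) v)"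

definition GH2 :: "pi_tree \<Rightarrow> bool" where
  "GH2 T \<longleftrightarrow> (\<exists>x y u v b. gen_henkin_pattern T x y u v b \<and> strict_prefix y b)"

definition coordinated :: "pi_tree \<Rightarrow> bool" where
  "coordinated T \<longleftrightarrow>
     (\<exists>x d y z u w.
        forall_at T x \<and> conn_at T d Or \<and> forall_at T y \<and> forall_at T z \<and>
        exists_at T u \<and> exists_at T w \<and>
        strict_prefix x d \<and> strict_prefix d u \<and> strict_prefix d w \<and>
        depends T u y \<and> \<not> depends T u x \<and> \<not> depends T u z \<and> \<not> depends T u w \<and>
        depends T w z \<and> \<not> depends T w x \<and> \<not> depends T w y \<and> \<not> depends T w u)"

end

theory Submission
  imports Defs
begin

text \<open>
  Without conjunctions the truth of a completion is the existence of Skolem functions that win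
  every play, the disjunctions being decided with full information at the end of the play. When
  the tree is not signalling, a Skolem function may be taken to depend only on the set D(u) of
  universal quantifiers that u depends on. If the tree is moreover not Henkin, these sets are
  comparable along each path; if it is neither GH2 nor coordinated, two incomparable ones belong
  to different sides of a disjunction, and one of them contains all universal quantifiers above
  it. Choosing D(u) of minimal size then shows that a quantifier can always be pulled to the
  front, or that all existential quantifiers on one side of some disjunction see everything above
  it; such a side is first-order relative to its context and can be moved into the leaves of the
  other side. Iterating yields a first-order prefix tree that is independent of the completion.
\<close>

section \<open>Skolem trees\<close>

text \<open>A universal quantifier may go first if every dependence set contains it, for then its
  value is a parameter of all Skolem functions; an existential one may if its dependence set
  consists of variables already in front. Up to such variables, a dependence set of minimal size
  that is comparable to all others lies inside them, so it supplies one or the other. The obstacle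
  is an incomparable pair, which can block both moves. Here the disjunction helps: turning one side
  into a property of the state removes its existential quantifiers from the competition. That
  property is not quantifier-free, which is why leaves are interpreted by arbitrary predicates and
  the variables that a leaf ignores are tracked semantically. The price is duplication: the absorbed
  side reappears at every leaf of the other side, so one gap of T can become many gaps of the
  first-order tree, all completed by the same formula. The excluded patterns enter only twice: all
  four give the invariant \<open>tame\<close>, and the absence of signalling also justifies
  forgetting what an existential quantifier sees of other existential ones.\<close>

text \<open>
  \<open>Exi u D t\<close> is an existential quantifier whose value may depend on the variables in \<open>D\<close> only. Leaves
  carry labels whose meaning, a predicate on states, is a parameter of the semantics: this makes the
  first-order tree found below independent of the completion.
\<close>

datatype 'g dtree =
    Lf 'g
  | Al nat "'g dtree"
  | Exi nat "nat set" "'g dtree"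
  | Disj "'g dtree" "'g dtree"

primrec nodes :: "'g dtree \<Rightarrow> nat" where
  "nodes (Lf g) = 1"
| "nodes (Al x t) = Suc (nodes t)"
| "nodes (Exi u D t) = Suc (nodes t)"
| "nodes (Disj l r) = nodes l + nodes r"

primrec leaves :: "'g dtree \<Rightarrow> 'g set" where
  "leaves (Lf g) = {g}"
| "leaves (Al x t) = leaves t"
| "leaves (Exi u D t) = leaves t"
| "leaves (Disj l r) = leaves l \<union> leaves r"

primrec univs :: "'g dtree \<Rightarrow> nat set" where
  "univs (Lf g) = {}"
| "univs (Al x t) = insert x (univs t)"
| "univs (Exi u D t) = univs t"
| "univs (Disj l r) = univs l \<union> univs r"

primrec exs :: "'g dtree \<Rightarrow> (nat \<times> nat set) set" where
  "exs (Lf g) = {}"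
| "exs (Al x t) = exs t"
| "exs (Exi u D t) = insert (u, D) (exs t)"
| "exs (Disj l r) = exs l \<union> exs r"

definition deps :: "'g dtree \<Rightarrow> nat set set" where
  "deps t = snd ` exs t"

lemma deps_simps [simp]:
  "deps (Lf g) = {}"
  "deps (Al x t) = deps t"
  "deps (Exi u D t) = insert D (deps t)"
  "deps (Disj l r) = deps l \<union> deps r"
  by (auto simp: deps_def)

lemma deps_mono: "exs t \<subseteq> exs t' \<Longrightarrow> deps t \<subseteq> deps t'"
  by (auto simp: deps_def)

definition bound :: "'g dtree \<Rightarrow> nat set" where
  "bound t = univs t \<union> fst ` exs t"

lemma bound_simps [simp]:
  "bound (Lf g) = {}"
  "bound (Al x t) = insert x (bound t)"
  "bound (Exi u D t) = insert u (bound t)"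
  "bound (Disj l r) = bound l \<union> bound r"
  by (auto simp: bound_def)

lemma univs_subset_bound: "univs t \<subseteq> bound t"
  by (simp add: bound_def)

lemma exs_bound: "(u, D) \<in> exs t \<Longrightarrow> u \<in> bound t"
  by (force simp: bound_def)

text \<open>\<open>W\<close> holds the universal variables in force above the tree; dependence sets
  draw on these only. Labels on the two sides of a disjunction are kept apart because absorption
  reinterprets the labels of one subtree and must not touch any other leaf.\<close>

primrec wf_dtree :: "nat set \<Rightarrow> 'g dtree \<Rightarrow> bool" where
  "wf_dtree W (Lf g) = True"
| "wf_dtree W (Al x t) = (x \<notin> bound t \<and> wf_dtree (insert x W) t)"
| "wf_dtree W (Exi u D t) = (u \<notin> bound t \<and> D \<subseteq> W \<and> wf_dtree W t)"
| "wf_dtree W (Disj l r) =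
     (bound l \<inter> bound r = {} \<and> leaves l \<inter> leaves r = {} \<and> wf_dtree W l \<and> wf_dtree W r)"

primrec del :: "nat \<Rightarrow> 'g dtree \<Rightarrow> 'g dtree" where
  "del x (Lf g) = Lf g"
| "del x (Al y t) = (if y = x then t else Al y (del x t))"
| "del x (Exi u D t) = (if u = x then t else Exi u D (del x t))"
| "del x (Disj l r) = Disj (del x l) (del x r)"

text \<open>A fixed dummy value outside \<open>D\<close> makes the restriction a total function from
  which nothing but the values on \<open>D\<close> can be read.\<close>

definition restr :: "(nat \<Rightarrow> 'a) \<Rightarrow> nat set \<Rightarrow> nat \<Rightarrow> 'a" where
  "restr s D = (\<lambda>x. if x \<in> D then s x else undefined)"

lemma restr_eq_iff: "restr s D = restr s' D \<longleftrightarrow> (\<forall>x\<in>D. s x = s' x)"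
  by (auto simp: restr_def fun_eq_iff)

lemma restr_upd [simp]: "x \<notin> D \<Longrightarrow> restr (s(x := a)) D = restr s D"
  by (auto simp: restr_def)

lemma restr_restr: "A \<subseteq> D \<Longrightarrow> restr (restr s D) A = restr s A"
  by (auto simp: restr_def fun_eq_iff)

text \<open>No choice function is needed at a disjunction: the Skolem functions are fixed for the
  whole tree, and the side taken is whichever wins from the current state. Indexing them by
  variables is unambiguous because well-formedness keeps variables distinct.\<close>

primrec win :: "'a set \<Rightarrow> ('g \<Rightarrow> (nat \<Rightarrow> 'a) \<Rightarrow> bool) \<Rightarrow> (nat \<Rightarrow> (nat \<Rightarrow> 'a) \<Rightarrow> 'a)
    \<Rightarrow> 'g dtree \<Rightarrow> (nat \<Rightarrow> 'a) \<Rightarrow> bool" where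
  "win C P F (Lf g) s = P g s"
| "win C P F (Al x t) s = (\<forall>a\<in>C. win C P F t (s(x := a)))"
| "win C P F (Exi u D t) s = win C P F t (s(u := F u (restr s D)))"
| "win C P F (Disj l r) s = (win C P F l s \<or> win C P F r s)"

definition skolem_sat :: "'a set \<Rightarrow> ('g \<Rightarrow> (nat \<Rightarrow> 'a) \<Rightarrow> bool) \<Rightarrow> 'g dtree \<Rightarrow> (nat \<Rightarrow> 'a) \<Rightarrow> bool" where
  "skolem_sat C P t s \<longleftrightarrow> (\<exists>F. (\<forall>u \<tau>. F u \<tau> \<in> C) \<and> win C P F t s)"

section \<open>Which variables a play can notice\<close>

definition insens :: "nat set \<Rightarrow> ((nat \<Rightarrow> 'a) \<Rightarrow> bool) \<Rightarrow> bool" where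
  "insens B p \<longleftrightarrow> (\<forall>s s'. (\<forall>x. x \<notin> B \<longrightarrow> s x = s' x) \<longrightarrow> p s = p s')"

text \<open>\<open>B\<close> contains the variables that are not bound above the current node; each leaf has to ignore
  the variables of \<open>B\<close> that are not bound on its own path.\<close>

primrec leaf_insens :: "nat set \<Rightarrow> 'g dtree \<Rightarrow> ('g \<Rightarrow> (nat \<Rightarrow> 'a) \<Rightarrow> bool) \<Rightarrow> bool" where
  "leaf_insens B (Lf g) P = insens B (P g)"
| "leaf_insens B (Al x t) P = leaf_insens (B - {x}) t P"
| "leaf_insens B (Exi u D t) P = leaf_insens (B - {u}) t P"
| "leaf_insens B (Disj l r) P = (leaf_insens B l P \<and> leaf_insens B r P)"

lemma insens_mono: "insens B p \<Longrightarrow> B' \<subseteq> B \<Longrightarrow> insens B' p"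
  unfolding insens_def by blast

lemma leaf_insens_mono: "leaf_insens B t P \<Longrightarrow> B' \<subseteq> B \<Longrightarrow> leaf_insens B' t P"
proof (induction t arbitrary: B B')
  case (Lf g) then show ?case by (auto intro: insens_mono)
next
  case (Al x t) from Al.prems show ?case by (auto intro!: Al.IH[of "B - {x}"])
next
  case (Exi u D t) from Exi.prems show ?case by (auto intro!: Exi.IH[of "B - {u}"])
next
  case (Disj l r)
  then show ?case by fastforce
qed

text \<open>A variable of \<open>B\<close> is either overwritten on the way to a leaf or ignored by
  that leaf, and Skolem functions read only variables of \<open>W\<close> or universal variables
  passed on the way.\<close>

lemma insens_win:
  assumes "leaf_insens B t P" "wf_dtree W t" "W \<inter> B = {}"
  shows "insens B (win C P F t)"
  using assms
proof (induction t arbitrary: B W)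
  case (Lf g) then show ?case by (simp add: insens_def)
next
  case (Al x t)
  have ih: "insens (B - {x}) (win C P F t)"
    using Al.IH[of "B - {x}" "insert x W"] Al.prems by auto
  show ?case unfolding insens_def
  proof (intro allI impI)
    fix s s' :: "nat \<Rightarrow> 'b" assume e: "\<forall>x. x \<notin> B \<longrightarrow> s x = s' x"
    have "win C P F t (s(x := a)) = win C P F t (s'(x := a))" for a
      by (rule ih[unfolded insens_def, rule_format]) (use e in auto)
    then show "win C P F (Al x t) s = win C P F (Al x t) s'" by simp
  qed
next
  case (Exi u D t)
  have ih: "insens (B - {u}) (win C P F t)"
    using Exi.IH[of "B - {u}" W] Exi.prems by auto
  show ?case unfolding insens_def
  proof (intro allI impI)
    fix s s' :: "nat \<Rightarrow> 'b" assume e: "\<forall>x. x \<notin> B \<longrightarrow> s x = s' x"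
    have r: "restr s D = restr s' D" using e Exi.prems by (auto simp: restr_eq_iff)
    have "win C P F t (s(u := a)) = win C P F t (s'(u := a))" for a
      by (rule ih[unfolded insens_def, rule_format]) (use e in auto)
    then show "win C P F (Exi u D t) s = win C P F (Exi u D t) s'" by (simp add: r)
  qed
next
  case (Disj l r)
  have "insens B (win C P F l)" "insens B (win C P F r)"
    using Disj by auto
  then show ?case unfolding insens_def by (metis win.simps(4))
qed

lemma insens_skolem_sat:
  assumes "leaf_insens B t P" "wf_dtree W t" "W \<inter> B = {}"
  shows "insens B (skolem_sat C P t)"
proof -
  have "win C P F t s = win C P F t s'" if "\<forall>x. x \<notin> B \<longrightarrow> s x = s' x" for F s s'
    using insens_win[OF assms] that unfolding insens_def by blast
  then show ?thesis unfolding insens_def skolem_sat_def by auto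
qed

lemma insens_upd: "insens B p \<Longrightarrow> x \<in> B \<Longrightarrow> p (s(x := a)) = p s"
  unfolding insens_def by (metis fun_upd_other)

lemma win_cong:
  assumes "\<And>g. g \<in> leaves t \<Longrightarrow> P g = P' g" "\<And>u. u \<in> bound t \<Longrightarrow> F u = F' u"
  shows "win C P F t s = win C P' F' t s"
  using assms by (induction t arbitrary: s) auto

lemma win_mono:
  assumes "\<And>g s. P g s \<Longrightarrow> P' g s" "win C P F t s"
  shows "win C P' F t s"
  using assms(2) by (induction t arbitrary: s) (auto simp: assms(1))

text \<open>Since \<open>A\<close> lies in every dependence set and is never rebound, each argument
  handed to a Skolem function still carries the initial values on \<open>A\<close>. Strategies that
  differ for each valuation of \<open>A\<close> can therefore be glued into one.\<close>

lemma win_cong_on: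
  assumes "\<And>u \<tau>. u \<in> bound t \<Longrightarrow> restr \<tau> A = restr s A \<Longrightarrow> F u \<tau> = F' u \<tau>"
    "\<forall>D\<in>deps t. A \<subseteq> D" "A \<inter> bound t = {}"
  shows "win C P F t s = win C P F' t s"
  using assms
proof (induction t arbitrary: s)
  case (Exi u D t)
  have "F u (restr s D) = F' u (restr s D)"
    using Exi.prems by (simp add: restr_restr)
  moreover have "win C P F t (s(u := a)) = win C P F' t (s(u := a))" for a
  proof (rule Exi.IH)
    fix v \<tau> assume v: "v \<in> bound t" "restr \<tau> A = restr (s(u := a)) A"
    have "u \<notin> A" using Exi.prems(3) by auto
    then show "F v \<tau> = F' v \<tau>" using v Exi.prems(1)[of v \<tau>] by simp
  qed (use Exi.prems in auto)
  ultimately show ?case by simp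
next
  case (Al x t)
  have "win C P F t (s(x := a)) = win C P F' t (s(x := a))" for a
  proof (rule Al.IH)
    fix v \<tau> assume v: "v \<in> bound t" "restr \<tau> A = restr (s(x := a)) A"
    have "x \<notin> A" using Al.prems(3) by auto
    then show "F v \<tau> = F' v \<tau>" using v Al.prems(1)[of v \<tau>] by simp
  qed (use Al.prems in auto)
  then show ?case by simp
next
  case (Disj l r)
  have "win C P F l s = win C P F' l s"
    by (rule Disj.IH(1)) (use Disj.prems in auto)
  moreover have "win C P F r s = win C P F' r s"
    by (rule Disj.IH(2)) (use Disj.prems in auto)
  ultimately show ?case by simp
qed simp

lemma win_if_all_leaves:
  assumes "\<And>g s'. g \<in> leaves t \<Longrightarrow> (\<forall>x. x \<notin> bound t \<longrightarrow> s x = s' x) \<Longrightarrow> P g s'"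
  shows "win C P F t s"
  using assms
proof (induction t arbitrary: s)
  case (Al x t)
  have "win C P F t (s(x := a))" for a
    by (rule Al.IH, rule Al.prems) auto
  then show ?case by simp
next
  case (Exi u D t)
  have "win C P F t (s(u := a))" for a
    by (rule Exi.IH, rule Exi.prems) auto
  then show ?case by simp
next
  case (Disj l r)
  have "win C P F l s"
    by (rule Disj.IH(1), rule Disj.prems) auto
  then show ?case by simp
qed auto

section \<open>Deleting a quantifier and moving it to the front\<close>

lemma del_id: "x \<notin> bound t \<Longrightarrow> del x t = t"
  by (induction t) auto

lemma nodes_pos: "0 < nodes t"
  by (induction t) auto

lemma nodes_del: "nodes (del x t) \<le> nodes t" "x \<in> bound t \<Longrightarrow> nodes (del x t) < nodes t"
proof -
  show le: "nodes (del x t) \<le> nodes t" for t :: "'a dtree" by (induction t) auto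
  show "x \<in> bound t \<Longrightarrow> nodes (del x t) < nodes t"
  proof (induction t)
    case (Disj l r)
    then show ?case using le[of l] le[of r] by force
  qed auto
qed

lemma leaves_del [simp]: "leaves (del x t) = leaves t"
  by (induction t) auto

lemma exs_del_subset: "exs (del x t) \<subseteq> exs t"
  by (induction t) auto

lemma bound_del: "wf_dtree W t \<Longrightarrow> bound (del x t) = bound t - {x}"
  by (induction t arbitrary: W) auto

lemma wf_mono: "wf_dtree W t \<Longrightarrow> W \<subseteq> W' \<Longrightarrow> wf_dtree W' t"
  by (induction t arbitrary: W W') (auto, (meson insert_mono)+)

text \<open>Dependence sets below a deleted universal quantifier may still mention its variable,
  hence the larger context.\<close>

lemma wf_del: "wf_dtree W t \<Longrightarrow> wf_dtree (insert x W) (del x t)"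
  by (induction t arbitrary: W)
    (auto simp: bound_del insert_commute intro: wf_mono)

lemma wf_del_ex:
  "wf_dtree W t \<Longrightarrow> x \<notin> univs t \<Longrightarrow> wf_dtree W (del x t)"
  by (induction t arbitrary: W) (auto simp: bound_del)

lemma leaf_insens_del: "leaf_insens B t P \<Longrightarrow> leaf_insens (B - {x}) (del x t) P"
proof (induction t arbitrary: B)
  case (Al y t)
  have "leaf_insens (B - {y} - {x}) (del x t) P" using Al by simp
  moreover have "B - {y} - {x} = B - {x} - {y}" by blast
  ultimately have "leaf_insens (B - {x} - {y}) (del x t) P" by (simp only:)
  then show ?case using Al.prems by auto
next
  case (Exi u D t)
  have "leaf_insens (B - {u} - {x}) (del x t) P" using Exi by simp
  moreover have "B - {u} - {x} = B - {x} - {u}" by blast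
  ultimately have "leaf_insens (B - {x} - {u}) (del x t) P" by (simp only:)
  then show ?case using Exi.prems by auto
qed (auto intro: insens_mono)

text \<open>On its way up the quantifier commutes with universal ones and passes a disjunction
  because the other side ignores \<open>x\<close>. It meets no existential quantifier: one above it
  would have \<open>x\<close> in its dependence set, although \<open>x\<close> is not yet in the
  context \<open>W\<close>.\<close>

lemma win_del_univ:
  assumes "leaf_insens B t P" "wf_dtree W t" "W \<inter> B = {}" "bound t \<subseteq> B"
    "x \<in> univs t" "\<forall>D\<in>deps t. x \<in> D"
  shows "win C P F t s \<longleftrightarrow> (\<forall>a\<in>C. win C P F (del x t) (s(x := a)))"
  using assms
proof (induction t arbitrary: B W s)
  case (Al y t)
  show ?case
  proof (cases "y = x")
    case False
    have "win C P F t (s(y := b)) \<longleftrightarrow> (\<forall>a\<in>C. win C P F (del x t) (s(y := b, x := a)))" for b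
      by (rule Al.IH[of "B - {y}" "insert y W"]) (use Al.prems False in auto)
    then have "win C P F (Al y t) s \<longleftrightarrow> (\<forall>b\<in>C. \<forall>a\<in>C. win C P F (del x t) (s(x := a, y := b)))"
      by (simp add: fun_upd_twist[OF False, of s])
    then show ?thesis using False by (auto simp del: fun_upd_apply)
  qed (simp del: fun_upd_apply)
next
  case (Exi u D t)
  have "x \<in> B" using Exi.prems(4,5) univs_subset_bound[of t] by auto
  moreover have "x \<in> W" using Exi.prems(2,6) by auto
  ultimately show ?case using Exi.prems(3) by blast
next
  case (Disj l r)
  have i: "insens B (win C P F l)" "insens B (win C P F r)"
    by (rule insens_win[of B _ P W]; use Disj.prems in simp)+
  have xB: "x \<in> B" using Disj.prems(4,5) univs_subset_bound[of "Disj l r"] by blast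
  have "x \<in> univs l \<or> x \<in> univs r" using Disj.prems by simp
  then show ?case
  proof
    assume x: "x \<in> univs l"
    then have nx: "x \<notin> bound r" using Disj.prems univs_subset_bound[of l] by auto
    have "win C P F l s \<longleftrightarrow> (\<forall>a\<in>C. win C P F (del x l) (s(x := a)))"
      by (rule Disj.IH(1)[of B W]) (use Disj.prems x in auto)
    then show ?thesis using insens_upd[OF i(2) xB] by (simp add: del_id[OF nx] del: fun_upd_apply)
  next
    assume x: "x \<in> univs r"
    then have nx: "x \<notin> bound l" using Disj.prems univs_subset_bound[of r] by auto
    have "win C P F r s \<longleftrightarrow> (\<forall>a\<in>C. win C P F (del x r) (s(x := a)))"
      by (rule Disj.IH(2)[of B W]) (use Disj.prems x in auto)
    then show ?thesis using insens_upd[OF i(1) xB] by (simp add: del_id[OF nx] del: fun_upd_apply)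
  qed
qed simp

text \<open>No node of the tree changes a variable of \<open>D\<close>, so the value of
  \<open>w\<close> is already determined at the root. Assigning it early disturbs neither the
  dependence sets met on the way, which lie in the context, nor the other side of a
  disjunction.\<close>

lemma win_del_ex:
  assumes "leaf_insens B t P" "wf_dtree W t" "W \<inter> B = {}" "bound t \<subseteq> B"
    "(w, D) \<in> exs t" "D \<inter> bound t = {}"
  shows "win C P F t s \<longleftrightarrow> win C P F (del w t) (s(w := F w (restr s D)))"
  using assms
proof (induction t arbitrary: B W s)
  case (Al y t)
  have w: "w \<in> bound t" using Al.prems(5) by (auto dest: exs_bound)
  then have ne: "y \<noteq> w" using Al.prems by auto
  have "win C P F t (s(y := b)) \<longleftrightarrow> win C P F (del w t) (s(y := b, w := F w (restr (s(y := b)) D)))" for b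
    by (rule Al.IH[of "B - {y}" "insert y W"]) (use Al.prems in auto)
  moreover have "restr (s(y := b)) D = restr s D" for b using Al.prems by auto
  moreover have "s(y := b, w := a) = s(w := a, y := b)" for a b using ne by (rule fun_upd_twist)
  moreover have "del w (Al y t) = Al y (del w t)" using ne by simp
  ultimately show ?case by (simp only: win.simps)
next
  case (Exi u D' t)
  show ?case
  proof (cases "u = w")
    case True
    have "(w, D) \<notin> exs t" using True Exi.prems(2) by (auto dest: exs_bound)
    then have "D' = D" using Exi.prems(5) by auto
    then show ?thesis using True by (simp del: fun_upd_apply)
  next
    case False
    have w: "(w, D) \<in> exs t" using Exi.prems(5) False by auto
    have wb: "w \<in> bound t" using w by (auto dest: exs_bound)
    have nw: "w \<notin> D'" using wb Exi.prems by auto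
    have "win C P F t (s(u := b)) \<longleftrightarrow> win C P F (del w t) (s(u := b, w := F w (restr (s(u := b)) D)))" for b
      by (rule Exi.IH[of "B - {u}" W]) (use Exi.prems w in auto)
    moreover have "u \<notin> D" using Exi.prems by auto
    ultimately show ?thesis using False nw by (simp add: fun_upd_twist[OF False, of s] del: fun_upd_apply)
  qed
next
  case (Disj l r)
  have i: "insens B (win C P F l)" "insens B (win C P F r)"
    by (rule insens_win[of B _ P W]; use Disj.prems in simp)+
  have ex: "(w, D) \<in> exs l \<or> (w, D) \<in> exs r" using Disj.prems(5) by simp
  then have "w \<in> bound (Disj l r)" by (auto dest: exs_bound)
  then have wB: "w \<in> B" using Disj.prems(4) by blast
  from ex show ?case
  proof
    assume x: "(w, D) \<in> exs l"
    then have "w \<in> bound l" by (auto dest: exs_bound)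
    then have nx: "w \<notin> bound r" using Disj.prems by auto
    have "win C P F l s \<longleftrightarrow> win C P F (del w l) (s(w := F w (restr s D)))"
      by (rule Disj.IH(1)[of B W]) (use Disj.prems x in auto)
    then show ?thesis using insens_upd[OF i(2) wB] by (simp add: del_id[OF nx] del: fun_upd_apply)
  next
    assume x: "(w, D) \<in> exs r"
    then have "w \<in> bound r" by (auto dest: exs_bound)
    then have nx: "w \<notin> bound l" using Disj.prems by auto
    have "win C P F r s \<longleftrightarrow> win C P F (del w r) (s(w := F w (restr s D)))"
      by (rule Disj.IH(2)[of B W]) (use Disj.prems x in auto)
    then show ?thesis using insens_upd[OF i(1) wB] by (simp add: del_id[OF nx] del: fun_upd_apply)
  qed
qed simp

lemma skolem_sat_del_univ:
  assumes "C \<noteq> {}" "leaf_insens B t P" "wf_dtree W t" "W \<inter> B = {}" "bound t \<subseteq> B"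
    "x \<in> univs t" "\<forall>D\<in>deps t. x \<in> D"
  shows "skolem_sat C P t s \<longleftrightarrow> (\<forall>a\<in>C. skolem_sat C P (del x t) (s(x := a)))"
proof
  assume "skolem_sat C P t s"
  then obtain F where F: "\<forall>u \<tau>. F u \<tau> \<in> C" "win C P F t s" unfolding skolem_sat_def by blast
  have "\<forall>a\<in>C. win C P F (del x t) (s(x := a))"
    using F(2) win_del_univ[OF assms(2-), of C F s] by simp
  then show "\<forall>a\<in>C. skolem_sat C P (del x t) (s(x := a))"
    using F(1) unfolding skolem_sat_def by (intro ballI exI[of _ F]) simp
next
  assume "\<forall>a\<in>C. skolem_sat C P (del x t) (s(x := a))"
  then have "\<exists>G. \<forall>a\<in>C. (\<forall>u \<tau>. G a u \<tau> \<in> C) \<and> win C P (G a) (del x t) (s(x := a))"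
    unfolding skolem_sat_def by (rule bchoice)
  then obtain G where G: "\<And>a. a \<in> C \<Longrightarrow> (\<forall>u \<tau>. G a u \<tau> \<in> C) \<and> win C P (G a) (del x t) (s(x := a))"
    by blast
  obtain c where c: "c \<in> C" using assms(1) by blast
  \<comment> \<open>Gluing: every Skolem function still in use sees \<open>x\<close>, so it can tell
    which of the strategies \<open>G a\<close> to follow. The constant \<open>c\<close> only keeps
    \<open>F\<close> inside \<open>C\<close> on arguments whose value at \<open>x\<close> is not in
    \<open>C\<close>.\<close>
  define F where "F u \<tau> = (if \<tau> x \<in> C then G (\<tau> x) u \<tau> else c)" for u \<tau>
  have "win C P F (del x t) (s(x := a))" if a: "a \<in> C" for a
  proof -
    have "win C P F (del x t) (s(x := a)) = win C P (G a) (del x t) (s(x := a))"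
    proof (rule win_cong_on[where A = "{x}"])
      show "F u \<tau> = G a u \<tau>" if "restr \<tau> {x} = restr (s(x := a)) {x}" for u \<tau>
        using that a by (simp add: restr_eq_iff F_def)
      show "\<forall>D\<in>deps (del x t). {x} \<subseteq> D"
        using assms(7) deps_mono[OF exs_del_subset[of x t]] by auto
      show "{x} \<inter> bound (del x t) = {}" using bound_del[OF assms(3)] by auto
    qed
    with G[OF a] show ?thesis by simp
  qed
  then have "win C P F t s" using win_del_univ[OF assms(2-), of C F s] by simp
  moreover have "\<forall>u \<tau>. F u \<tau> \<in> C" using G c by (simp add: F_def)
  ultimately show "skolem_sat C P t s" unfolding skolem_sat_def by (intro exI[of _ F] conjI)
qed

lemma skolem_sat_del_ex:
  assumes "leaf_insens B t P" "wf_dtree W t" "W \<inter> B = {}" "bound t \<subseteq> B"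
    "(w, D) \<in> exs t" "D \<inter> bound t = {}"
  shows "skolem_sat C P t s \<longleftrightarrow> (\<exists>a\<in>C. skolem_sat C P (del w t) (s(w := a)))"
proof
  assume "skolem_sat C P t s"
  then obtain F where F: "\<forall>u \<tau>. F u \<tau> \<in> C" "win C P F t s" unfolding skolem_sat_def by blast
  from F(2) have "win C P F (del w t) (s(w := F w (restr s D)))"
    by (simp only: win_del_ex[OF assms, of C F s])
  then have "skolem_sat C P (del w t) (s(w := F w (restr s D)))"
    using F(1) unfolding skolem_sat_def by (intro exI[of _ F] conjI)
  then show "\<exists>a\<in>C. skolem_sat C P (del w t) (s(w := a))"
    using F(1) by (intro bexI[of _ "F w (restr s D)"]) simp_all
next
  assume "\<exists>a\<in>C. skolem_sat C P (del w t) (s(w := a))"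
  then obtain a F where a: "a \<in> C" "\<forall>u \<tau>. F u \<tau> \<in> C" "win C P F (del w t) (s(w := a))"
    unfolding skolem_sat_def by blast
  \<comment> \<open>A constant function is allowed whatever \<open>D\<close> is, and the rest of the
    play never consults it, because \<open>w\<close> no longer occurs in the deleted tree.\<close>
  let ?F = "F(w := \<lambda>_. a)"
  have "win C P ?F (del w t) (s(w := a)) = win C P F (del w t) (s(w := a))"
    by (rule win_cong) (use bound_del[OF assms(2)] in auto)
  then have "win C P ?F t s" using win_del_ex[OF assms, of C ?F s] a by simp
  moreover have "\<forall>u \<tau>. ?F u \<tau> \<in> C" using a by simp
  ultimately show "skolem_sat C P t s" unfolding skolem_sat_def by (intro exI[of _ ?F] conjI)
qed

section \<open>Pulling out quantifiers and absorbing disjuncts\<close>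

text \<open>\<open>\<Gamma>\<close> collects the universal variables that have already been pulled out: within a fixed state
  they are constants, so that dependence on them is immaterial.\<close>

definition comparable :: "nat set \<Rightarrow> nat set \<Rightarrow> nat set \<Rightarrow> bool" where
  "comparable \<Gamma> D D' \<longleftrightarrow> D \<subseteq> D' \<union> \<Gamma> \<or> D' \<subseteq> D \<union> \<Gamma>"

text \<open>The trace that the excluded patterns leave in Skolem trees: \<open>A\<close> is the set
  of universal variables above that have not been pulled out, and incomparable dependence sets can
  part only at a disjunction above which one of them sees everything.\<close>

primrec tame :: "nat set \<Rightarrow> nat set \<Rightarrow> 'g dtree \<Rightarrow> bool" where
  "tame \<Gamma> A (Lf g) = True"
| "tame \<Gamma> A (Al x t) = tame \<Gamma> (insert x A) t"
| "tame \<Gamma> A (Exi u D t) = ((\<forall>D'\<in>deps t. comparable \<Gamma> D D') \<and> tame \<Gamma> A t)"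
| "tame \<Gamma> A (Disj l r) = (tame \<Gamma> A l \<and> tame \<Gamma> A r \<and>
     (\<forall>D\<in>deps l. \<forall>D'\<in>deps r. comparable \<Gamma> D D' \<or> A \<subseteq> D \<union> \<Gamma> \<or> A \<subseteq> D' \<union> \<Gamma>))"

text \<open>\<open>repl s s' A t A' t'\<close>: replacing one occurrence of \<open>s\<close> in \<open>t\<close> by \<open>s'\<close> gives \<open>t'\<close>; if \<open>A\<close> are the
  universal variables above \<open>t\<close> then \<open>A'\<close> are those above the occurrence.\<close>

inductive repl :: "'g dtree \<Rightarrow> 'g dtree \<Rightarrow> nat set \<Rightarrow> 'g dtree \<Rightarrow> nat set \<Rightarrow> 'g dtree \<Rightarrow> bool"
  for s s' where
  repl_here: "repl s s' A s A s'"
| repl_Al: "repl s s' (insert x A) t A' t' \<Longrightarrow> repl s s' A (Al x t) A' (Al x t')"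
| repl_Ex: "repl s s' A t A' t' \<Longrightarrow> repl s s' A (Exi u D t) A' (Exi u D t')"
| repl_left: "repl s s' A l A' l' \<Longrightarrow> repl s s' A (Disj l r) A' (Disj l' r)"
| repl_right: "repl s s' A r A' r' \<Longrightarrow> repl s s' A (Disj l r) A' (Disj l r')"

section \<open>Stability of tameness, and where incomparable dependence sets part\<close>

lemma comparable_mono: "comparable \<Gamma> D D' \<Longrightarrow> \<Gamma> \<subseteq> \<Gamma>' \<Longrightarrow> comparable \<Gamma>' D D'"
  unfolding comparable_def by blast

lemma comparable_sym: "comparable \<Gamma> D D' \<longleftrightarrow> comparable \<Gamma> D' D"
  unfolding comparable_def by blast

lemma tame_mono: "tame \<Gamma> A t \<Longrightarrow> \<Gamma> \<subseteq> \<Gamma>' \<Longrightarrow> A' \<subseteq> A \<Longrightarrow> tame \<Gamma>' A' t"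
proof (induction t arbitrary: A A')
  case (Al x t)
  show ?case using Al.IH[of "insert x A" "insert x A'"] Al.prems by auto
next
  case (Exi u D t)
  have "tame \<Gamma>' A' t" using Exi.IH[of A A'] Exi.prems by auto
  then show ?case using Exi.prems by (auto intro: comparable_mono)
next
  case (Disj l r)
  have "tame \<Gamma>' A' l" "tame \<Gamma>' A' r" using Disj.IH[of A A'] Disj.prems by auto
  moreover have "comparable \<Gamma>' D D' \<or> A' \<subseteq> D \<union> \<Gamma>' \<or> A' \<subseteq> D' \<union> \<Gamma>'"
    if "D \<in> deps l" "D' \<in> deps r" for D D'
  proof -
    have "comparable \<Gamma> D D' \<or> A \<subseteq> D \<union> \<Gamma> \<or> A \<subseteq> D' \<union> \<Gamma>"
      using Disj.prems(1) that unfolding tame.simps by blast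
    then show ?thesis using Disj.prems(2,3) comparable_mono[of \<Gamma> D D' \<Gamma>'] by blast
  qed
  ultimately show ?case unfolding tame.simps by blast
qed simp

lemma deps_del_subset: "deps (del x t) \<subseteq> deps t"
  using exs_del_subset by (rule deps_mono)

text \<open>Deleting \<open>x\<close> can only shrink the set of universal variables above a node,
  and adding it to \<open>\<Gamma>\<close> discounts it in every comparison; both changes weaken the
  conditions.\<close>

lemma tame_del: "tame \<Gamma> A t \<Longrightarrow> tame (insert x \<Gamma>) A (del x t)"
proof (induction t arbitrary: A)
  case (Al y t)
  show ?case
  proof (cases "y = x")
    case True
    then show ?thesis using Al.prems tame_mono[of \<Gamma> "insert x A" t "insert x \<Gamma>" A] by auto
  qed (use Al in simp)
next
  case (Exi u D t)
  have "comparable (insert x \<Gamma>) D D'" if "D' \<in> deps (del x t)" for D'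
  proof (rule comparable_mono[of \<Gamma>])
    show "comparable \<Gamma> D D'" using Exi.prems that deps_del_subset[of x t] unfolding tame.simps by blast
  qed blast
  then show ?case using Exi tame_mono[of \<Gamma> A t "insert x \<Gamma>" A] by auto
next
  case (Disj l r)
  have "tame (insert x \<Gamma>) A (Disj l r)"
    using tame_mono[OF Disj.prems, of "insert x \<Gamma>" A] by blast
  then show ?case using Disj deps_del_subset[of x l] deps_del_subset[of x r]
    unfolding tame.simps del.simps by (meson subsetD)
qed simp

lemma tame_del_ex: "tame \<Gamma> A t \<Longrightarrow> x \<notin> univs t \<Longrightarrow> tame \<Gamma> A (del x t)"
proof (induction t arbitrary: A)
  case (Exi u D t)
  then show ?case using deps_del_subset[of x t] by auto
next
  case (Disj l r)
  then show ?case using deps_del_subset[of x l] deps_del_subset[of x r]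
    unfolding tame.simps del.simps univs.simps by (meson subsetD UnCI)
qed auto

lemma wf_deps_subset: "wf_dtree W t \<Longrightarrow> D \<in> deps t \<Longrightarrow> D \<subseteq> W \<union> univs t"
proof (induction t arbitrary: W)
  case (Al x t)
  show ?case using Al.IH[of "insert x W"] Al.prems by auto
next
  case (Exi u D' t)
  show ?case using Exi.IH[of W] Exi.prems by auto
next
  case (Disj l r)
  show ?case using Disj.IH[of W] Disj.prems by auto
qed simp

lemma finite_univs: "finite (univs t)"
  by (induction t) auto

lemma finite_exs: "finite (exs t)"
  by (induction t) auto

lemma repl_site:
  assumes "repl s s' A t A' t'" "wf_dtree (\<Gamma> \<union> A) t" "(\<Gamma> \<union> A) \<inter> bound t = {}"
  shows "wf_dtree (\<Gamma> \<union> A') s \<and> (\<Gamma> \<union> A') \<inter> bound s = {} \<and> A \<subseteq> A' \<and> A' \<subseteq> A \<union> univs t \<and>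
    bound s \<subseteq> bound t \<and> leaves s \<subseteq> leaves t \<and> exs s \<subseteq> exs t \<and> nodes s \<le> nodes t"
  using assms
proof induction
  case (repl_Al x A t A' t')
  have "wf_dtree (\<Gamma> \<union> insert x A) t" "(\<Gamma> \<union> insert x A) \<inter> bound t = {}"
    using repl_Al.prems by auto
  with repl_Al.IH show ?case by auto
next
  case (repl_Ex A t A' t' u D)
  have "wf_dtree (\<Gamma> \<union> A) t" "(\<Gamma> \<union> A) \<inter> bound t = {}"
    using repl_Ex.prems by auto
  with repl_Ex.IH show ?case by auto
next
  case (repl_left A l A' l' r)
  have "wf_dtree (\<Gamma> \<union> A) l" "(\<Gamma> \<union> A) \<inter> bound l = {}"
    using repl_left.prems by auto
  with repl_left.IH show ?case by auto
next
  case (repl_right A r A' r' l)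
  have "wf_dtree (\<Gamma> \<union> A) r" "(\<Gamma> \<union> A) \<inter> bound r = {}"
    using repl_right.prems by auto
  with repl_right.IH show ?case by auto
qed auto

lemma repl_tame_site: "repl s s' A t A' t' \<Longrightarrow> tame \<Gamma> A t \<Longrightarrow> tame \<Gamma> A' s"
  by (induction rule: repl.induct) auto

lemma repl_trans:
  "repl s0 s0' A t A0 t0 \<Longrightarrow> repl s s' A0 s0 A' s0'' \<Longrightarrow> \<exists>t'. repl s s' A t A' t'"
  by (induction rule: repl.induct) (auto intro: repl.intros)

lemma repl_result:
  assumes "repl s s' A t A' t'" "wf_dtree (\<Gamma> \<union> A) t" "tame \<Gamma> A t"
    and s: "s = Disj l s' \<or> s = Disj s' l"
  shows "wf_dtree (\<Gamma> \<union> A) t' \<and> tame \<Gamma> A t' \<and> bound t' \<subseteq> bound t \<and> leaves t' \<subseteq> leaves t \<and>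
    exs t' \<subseteq> exs t \<and> univs t' \<subseteq> univs t \<and> nodes t' < nodes t"
  using assms(1-3)
proof induction
  case (repl_here A)
  then show ?case using s nodes_pos[of l] by auto
next
  case (repl_left A l A' l' r)
  then have ih: "wf_dtree (\<Gamma> \<union> A) l'" "tame \<Gamma> A l'" "bound l' \<subseteq> bound l" "leaves l' \<subseteq> leaves l"
    "exs l' \<subseteq> exs l" "univs l' \<subseteq> univs l" "nodes l' < nodes l" by auto
  then have "deps l' \<subseteq> deps l" by (intro deps_mono)
  then have "\<forall>D\<in>deps l'. \<forall>D'\<in>deps r. comparable \<Gamma> D D' \<or> A \<subseteq> D \<union> \<Gamma> \<or> A \<subseteq> D' \<union> \<Gamma>"
    using repl_left.prems(2) unfolding tame.simps by blast
  then have "tame \<Gamma> A (Disj l' r)" using ih repl_left.prems(2) unfolding tame.simps by blast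
  then show ?case using ih repl_left.prems(1) by auto
next
  case (repl_right A r A' r' l)
  then have ih: "wf_dtree (\<Gamma> \<union> A) r'" "tame \<Gamma> A r'" "bound r' \<subseteq> bound r" "leaves r' \<subseteq> leaves r"
    "exs r' \<subseteq> exs r" "univs r' \<subseteq> univs r" "nodes r' < nodes r" by auto
  then have "deps r' \<subseteq> deps r" by (intro deps_mono)
  then have "\<forall>D\<in>deps l. \<forall>D'\<in>deps r'. comparable \<Gamma> D D' \<or> A \<subseteq> D \<union> \<Gamma> \<or> A \<subseteq> D' \<union> \<Gamma>"
    using repl_right.prems(2) unfolding tame.simps by blast
  then have "tame \<Gamma> A (Disj l r')" using ih repl_right.prems(2) unfolding tame.simps by blast
  then show ?case using ih repl_right.prems(1) by auto
next
  case (repl_Ex A t A' t' u D)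
  then have ih: "wf_dtree (\<Gamma> \<union> A) t'" "tame \<Gamma> A t'" "bound t' \<subseteq> bound t" "leaves t' \<subseteq> leaves t"
    "exs t' \<subseteq> exs t" "univs t' \<subseteq> univs t" "nodes t' < nodes t" by auto
  then have "deps t' \<subseteq> deps t" by (intro deps_mono)
  then show ?case using ih repl_Ex.prems by auto
qed (auto simp: subset_eq)

text \<open>Follow the two sets down the tree. An existential node carries a set comparable to all
  those below it, so it cannot separate the pair; they part at a disjunction, where
  \<open>tame\<close> yields the last alternative. The replacement \<open>s'\<close> is arbitrary,
  as \<open>repl\<close> serves here only to name a position.\<close>

lemma not_comparable_meet:
  assumes "tame \<Gamma> A t" "D1 \<in> deps t" "D2 \<in> deps t" "\<not> comparable \<Gamma> D1 D2"
  shows "\<exists>l r A'. (\<exists>t'. repl (Disj l r) s' A t A' t') \<and> A \<subseteq> A' \<and>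
    D1 \<in> deps (Disj l r) \<and> D2 \<in> deps (Disj l r) \<and>
    (A' \<subseteq> D1 \<union> \<Gamma> \<or> A' \<subseteq> D2 \<union> \<Gamma>)"
  using assms
proof (induction t arbitrary: A)
  case (Al x t)
  obtain l r A' t' where "repl (Disj l r) s' (insert x A) t A' t'" "insert x A \<subseteq> A'"
     "D1 \<in> deps (Disj l r)" "D2 \<in> deps (Disj l r)" "A' \<subseteq> D1 \<union> \<Gamma> \<or> A' \<subseteq> D2 \<union> \<Gamma>"
    using Al.IH[of "insert x A"] Al.prems by auto
  then show ?case by (meson insert_subset repl_Al)
next
  case (Exi u D t)
  have "comparable \<Gamma> D D" by (simp add: comparable_def)
  then have "D1 \<in> deps t" "D2 \<in> deps t"
    using Exi.prems comparable_sym[of \<Gamma> D1 D2] by auto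
  then obtain l r A' t' where "repl (Disj l r) s' A t A' t'" "A \<subseteq> A'"
     "D1 \<in> deps (Disj l r)" "D2 \<in> deps (Disj l r)" "A' \<subseteq> D1 \<union> \<Gamma> \<or> A' \<subseteq> D2 \<union> \<Gamma>"
    using Exi.IH[of A] Exi.prems by auto
  then show ?case by (meson repl_Ex)
next
  case (Disj l r)
  consider "D1 \<in> deps l" "D2 \<in> deps l" | "D1 \<in> deps r" "D2 \<in> deps r"
    | "D1 \<in> deps l" "D2 \<in> deps r" | "D1 \<in> deps r" "D2 \<in> deps l"
    using Disj.prems by auto
  then show ?case
  proof cases
    case 1
    with Disj.IH(1)[of A] Disj.prems obtain l0 r0 A' t' where "repl (Disj l0 r0) s' A l A' t'"
      "A \<subseteq> A'" "D1 \<in> deps (Disj l0 r0)" "D2 \<in> deps (Disj l0 r0)" "A' \<subseteq> D1 \<union> \<Gamma> \<or> A' \<subseteq> D2 \<union> \<Gamma>" by auto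
    then show ?thesis by (meson repl_left)
  next
    case 2
    with Disj.IH(2)[of A] Disj.prems obtain l0 r0 A' t' where "repl (Disj l0 r0) s' A r A' t'"
      "A \<subseteq> A'" "D1 \<in> deps (Disj l0 r0)" "D2 \<in> deps (Disj l0 r0)" "A' \<subseteq> D1 \<union> \<Gamma> \<or> A' \<subseteq> D2 \<union> \<Gamma>" by auto
    then show ?thesis by (meson repl_right)
  next
    case 3
    then have "A \<subseteq> D1 \<union> \<Gamma> \<or> A \<subseteq> D2 \<union> \<Gamma>"
      using Disj.prems unfolding tame.simps by blast
    then show ?thesis using repl_here[of "Disj l r" s' A] Disj.prems(2,3) by blast
  next
    case 4
    then have "A \<subseteq> D1 \<union> \<Gamma> \<or> A \<subseteq> D2 \<union> \<Gamma>"
      using Disj.prems comparable_sym[of \<Gamma> D1 D2] unfolding tame.simps by blast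
    then show ?thesis using repl_here[of "Disj l r" s' A] Disj.prems(2,3) by blast
  qed
qed simp


text \<open>The case \<open>absorb\<close> arises from an existential variable whose dependence set \<open>w\<close> is of minimal size
  and incomparable to some other one. If neither side of the disjunction where they part could be
  absorbed, a dependence set \<open>m\<close> properly contained in \<open>A'\<close> would contradict minimality of \<open>w\<close>.\<close>

lemma pull_or_absorb:
  assumes wf: "wf_dtree \<Gamma> t" and disj: "\<Gamma> \<inter> bound t = {}" and tame: "tame \<Gamma> {} t"
  obtains (leaf) g where "t = Lf g"
    | (univ) x where "x \<in> univs t" "\<forall>D\<in>deps t. x \<in> D"
    | (ex) w D where "(w, D) \<in> exs t" "D \<subseteq> \<Gamma>"
    | (absorb) s l s' A' t' where "s = Disj l s' \<or> s = Disj s' l" "repl s s' {} t A' t'"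
        "\<forall>D\<in>deps l. A' \<subseteq> D \<union> \<Gamma>"
proof (rule ccontr)
  assume "\<not> thesis"
  have noleaf: "t \<noteq> Lf g" for g using leaf \<open>\<not> thesis\<close> by blast
  have nouniv: "\<exists>D\<in>deps t. x \<notin> D" if "x \<in> univs t" for x
    using univ[OF that] \<open>\<not> thesis\<close> by blast
  have noex: "\<not> D \<subseteq> \<Gamma>" if "(w, D) \<in> exs t" for w D
    using ex[OF that] \<open>\<not> thesis\<close> by blast
  have noabsorb: "\<exists>D\<in>deps l. \<not> A' \<subseteq> D \<union> \<Gamma>"
    if "s = Disj l s' \<or> s = Disj s' l" "repl s s' {} t A' t'" for s l s' A' t'
    using absorb[OF that] \<open>\<not> thesis\<close> by blast
  \<comment> \<open>Without existential quantifiers the root falls under one of the cases vacuously: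
    a universal quantifier can be pulled, and a disjunction can absorb its left side.\<close>
  have "deps t \<noteq> {}"
  proof
    assume e: "deps t = {}"
    show False
    proof (cases t)
      case (Lf g) with noleaf show False by blast
    next
      case (Al x t0) with nouniv[of x] e show False by simp
    next
      case (Exi u D t0) with e show False by simp
    next
      case (Disj l r)
      with noabsorb[of t l r, OF _ repl_here] e show False by simp
    qed
  qed
  then obtain D0 where "D0 \<in> deps t" by blast
  \<comment> \<open>Variables of \<open>\<Gamma>\<close> are constants, so they do not count in the
    size that is minimised.\<close>
  then obtain w where w: "w \<in> deps t" and
    wmin: "\<And>D. D \<in> deps t \<Longrightarrow> card (w - \<Gamma>) \<le> card (D - \<Gamma>)"
    using ex_has_least_nat[of "\<lambda>D. D \<in> deps t" D0 "\<lambda>D. card (D - \<Gamma>)"] by blast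
  have wleast: "w \<subseteq> D \<union> \<Gamma>" if "D \<in> deps t" "D \<subseteq> w \<union> \<Gamma>" for D
  proof -
    have "w - \<Gamma> \<subseteq> univs t" using wf_deps_subset[OF wf w] by blast
    then have "finite (w - \<Gamma>)" using finite_univs finite_subset by blast
    moreover have "D - \<Gamma> \<subseteq> w - \<Gamma>" using that by blast
    ultimately have "D - \<Gamma> = w - \<Gamma>" using wmin[OF that(1)] by (rule card_seteq)
    then show ?thesis by blast
  qed
  obtain u0 where "(u0, w) \<in> exs t" using w unfolding deps_def by auto
  \<comment> \<open>\<open>w\<close> needs some variable not yet pulled out. As \<open>z\<close>
    cannot be pulled out either, some \<open>u\<close> misses it, and minimality of \<open>w\<close>
    then makes the two incomparable.\<close>
  then obtain z where z: "z \<in> w" "z \<notin> \<Gamma>" using noex by blast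
  then have "z \<in> univs t" using wf_deps_subset[OF wf w] by blast
  then obtain u where u: "u \<in> deps t" "z \<notin> u" using nouniv by blast
  have "\<not> comparable \<Gamma> w u" using wleast[OF u(1)] u z unfolding comparable_def by blast
  from not_comparable_meet[OF tame w u(1) this, of t]
  obtain l r A' t0 where rep0: "repl (Disj l r) t {} t A' t0"
    and AA: "A' \<subseteq> w \<union> \<Gamma> \<or> A' \<subseteq> u \<union> \<Gamma>" and mem: "w \<in> deps (Disj l r)"
    by blast
  obtain t' where rep: "repl (Disj l r) l {} t A' t'"
    using repl_trans[OF rep0 repl_here] by blast
  obtain t'' where rep': "repl (Disj l r) r {} t A' t''"
    using repl_trans[OF rep0 repl_here] by blast
  obtain v where v: "v \<in> deps r" "\<not> A' \<subseteq> v \<union> \<Gamma>" using noabsorb[OF _ rep] by blast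
  obtain v' where v': "v' \<in> deps l" "\<not> A' \<subseteq> v' \<union> \<Gamma>" using noabsorb[OF _ rep'] by blast
  have site: "wf_dtree (\<Gamma> \<union> A') (Disj l r)" "exs (Disj l r) \<subseteq> exs t"
    using repl_site[OF rep, of \<Gamma>] wf disj by auto
  have tsite: "tame \<Gamma> A' (Disj l r)" using repl_tame_site[OF rep tame] .
  have comp: "comparable \<Gamma> v' v" using tsite v v' by auto
  \<comment> \<open>Two comparable sets from opposite sides share only variables from above the
    disjunction, so the smaller one, called \<open>m\<close> below, lies within \<open>A'\<close> up
    to \<open>\<Gamma>\<close>.\<close>
  have "v \<subseteq> \<Gamma> \<union> A' \<union> univs r" "v' \<subseteq> \<Gamma> \<union> A' \<union> univs l" "univs l \<inter> univs r = {}"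
    using site(1) wf_deps_subset v(1) v'(1) univs_subset_bound[of l] univs_subset_bound[of r]
    by auto
  then have "v \<subseteq> A' \<union> \<Gamma> \<or> v' \<subseteq> A' \<union> \<Gamma>" using comp unfolding comparable_def by blast
  then obtain m where m: "m \<in> deps (Disj l r)" "m \<subseteq> A' \<union> \<Gamma>" "\<not> A' \<subseteq> m \<union> \<Gamma>"
    using v v' by auto
  have mt: "m \<in> deps t" using m(1) deps_mono[OF site(2)] by blast
  \<comment> \<open>If \<open>w\<close> covered \<open>A'\<close>, it would contain
    \<open>m\<close>, hence by minimality be contained in \<open>m\<close>, and \<open>m\<close>
    would cover \<open>A'\<close> as well.\<close>
  have nw: "\<not> A' \<subseteq> w \<union> \<Gamma>" using wleast[OF mt] m by blast
  then have "A' \<subseteq> u \<union> \<Gamma>" using AA by blast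
  then have "\<not> w \<subseteq> A' \<union> \<Gamma>" using z u by blast
  then have "\<not> comparable \<Gamma> w m" using wleast[OF mt] m(2) unfolding comparable_def by blast
  \<comment> \<open>Applied inside the disjunction: \<open>w\<close> and \<open>m\<close> part below
    it, where one of them must cover a superset of \<open>A'\<close>, although neither covers
    \<open>A'\<close>.\<close>
  from not_comparable_meet[OF tsite mem m(1) this]
  show False using nw m(3) by blast
qed

section \<open>Absorbing one side of a disjunction into the leaves of the other\<close>

lemma leaf_insens_cong:
  "(\<And>g. g \<in> leaves t \<Longrightarrow> P g = P' g) \<Longrightarrow> leaf_insens B t P = leaf_insens B t P'"
  by (induction t arbitrary: B) auto

lemma leaf_insens_or:
  "leaf_insens B t P \<Longrightarrow> insens B q \<Longrightarrow> leaf_insens B t (\<lambda>g \<sigma>. P g \<sigma> \<or> (g \<in> G \<and> q \<sigma>))"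
proof (induction t arbitrary: B)
  case (Lf g)
  then show ?case unfolding leaf_insens.simps insens_def by blast
next
  case (Al x t)
  show ?case using Al.IH[of "B - {x}"] Al.prems insens_mono[of B q "B - {x}"] by auto
next
  case (Exi u D t)
  show ?case using Exi.IH[of "B - {u}"] Exi.prems insens_mono[of B q "B - {u}"] by auto
qed auto

text \<open>If all existential variables of the disjunct \<open>l\<close> see all universal variables above it, its Skolem
  functions can be chosen separately for each state at the disjunction. Hence \<open>l\<close> acts as a
  predicate of that state, which may be evaluated as late as at the leaves of the other disjunct.\<close>

definition absorbed ::
  "'a set \<Rightarrow> ('g \<Rightarrow> (nat \<Rightarrow> 'a) \<Rightarrow> bool) \<Rightarrow> 'g dtree \<Rightarrow> 'g dtree \<Rightarrow> 'g \<Rightarrow> (nat \<Rightarrow> 'a) \<Rightarrow> bool" where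
  "absorbed C P l s' g \<sigma> \<longleftrightarrow> P g \<sigma> \<or> (g \<in> leaves s' \<and> skolem_sat C P l \<sigma>)"

lemma absorbed_off: "g \<notin> leaves s' \<Longrightarrow> absorbed C P l s' g = P g"
  by (auto simp: absorbed_def fun_eq_iff)

lemma repl_leaves: "repl s s' A t A' t' \<Longrightarrow> leaves s \<subseteq> leaves t"
  by (induction rule: repl.induct) auto

lemma repl_bound: "repl s s' A t A' t' \<Longrightarrow> bound s \<subseteq> bound t"
  by (induction rule: repl.induct) auto

text \<open>The truth of \<open>l\<close> is settled by the state at the disjunction, so the
  predicates added at the leaves of \<open>s'\<close> read only variables bound above it.\<close>

lemma leaf_insens_absorbed:
  assumes "repl s s' A t A' t'" "wf_dtree (\<Gamma> \<union> A) t" "(\<Gamma> \<union> A) \<inter> B = {}" "bound t \<subseteq> B"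
    "leaf_insens B t P" and s: "s = Disj l s' \<or> s = Disj s' l"
  shows "leaf_insens B t' (absorbed C P l s')"
  using assms(1-5)
proof (induction arbitrary: B)
  case (repl_here A)
  have "insens B (skolem_sat C P l)"
    by (rule insens_skolem_sat[of B l P "\<Gamma> \<union> A"]) (use repl_here s in auto)
  moreover have "leaf_insens B s' P" using repl_here s by auto
  ultimately show ?case using leaf_insens_or[of B s' P _ "leaves s'"] unfolding absorbed_def by blast
next
  case (repl_Al x A t A' t')
  show ?case using repl_Al.IH[of "B - {x}"] repl_Al.prems by auto
next
  case (repl_Ex A t A' t' u D)
  show ?case using repl_Ex.IH[of "B - {u}"] repl_Ex.prems by auto
next
  case (repl_left A l0 A' l' r)
  have "leaf_insens B r (absorbed C P l s') = leaf_insens B r P"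
    by (rule leaf_insens_cong, rule absorbed_off)
      (use repl_leaves[OF repl_left.hyps] repl_left.prems s in auto)
  then show ?case using repl_left.IH[of B] repl_left.prems by auto
next
  case (repl_right A r A' r' l0)
  have "leaf_insens B l0 (absorbed C P l s') = leaf_insens B l0 P"
    by (rule leaf_insens_cong, rule absorbed_off)
      (use repl_leaves[OF repl_right.hyps] repl_right.prems s in auto)
  then show ?case using repl_right.IH[of B] repl_right.prems by auto
qed

lemma exs_not_univ: "wf_dtree W t \<Longrightarrow> (w, D) \<in> exs t \<Longrightarrow> w \<notin> univs t"
proof (induction t arbitrary: W)
  case (Exi u D' t)
  then show ?case using univs_subset_bound[of t] by auto
next
  case (Disj l r)
  then show ?case using univs_subset_bound[of l] univs_subset_bound[of r]
      exs_bound[of w D l] exs_bound[of w D r] by auto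
qed (auto dest: exs_bound)

lemma leaf_insens_site:
  assumes "repl s s' A t A' t'" "wf_dtree W t" "leaf_insens B t P" "bound s \<subseteq> B"
  shows "leaf_insens (bound s) s P"
  using assms
proof (induction arbitrary: B W)
  case (repl_here A)
  then show ?case by (auto intro: leaf_insens_mono)
next
  case (repl_Al x A t A' t')
  show ?case
    by (rule repl_Al.IH[of "insert x W" "B - {x}"])
      (use repl_Al.prems repl_bound[OF repl_Al.hyps] in auto)
next
  case (repl_Ex A t A' t' u D)
  show ?case
    by (rule repl_Ex.IH[of W "B - {u}"])
      (use repl_Ex.prems repl_bound[OF repl_Ex.hyps] in auto)
qed auto

lemma win_cong_reach:
  assumes "\<And>g s'. g \<in> leaves t \<Longrightarrow> (\<forall>x. x \<notin> bound t \<longrightarrow> s x = s' x) \<Longrightarrow> P g s' = P' g s'"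
  shows "win C P F t s = win C P' F t s"
  using assms
proof (induction t arbitrary: s)
  case (Al x t)
  have "win C P F t (s(x := a)) = win C P' F t (s(x := a))" for a
    by (rule Al.IH, rule Al.prems) auto
  then show ?case by (simp del: fun_upd_apply)
next
  case (Exi u D t)
  have "win C P F t (s(u := a)) = win C P' F t (s(u := a))" for a
    by (rule Exi.IH, rule Exi.prems) auto
  then show ?case by (simp del: fun_upd_apply)
next
  case (Disj l r)
  have "win C P F l s = win C P' F l s"
    by (rule Disj.IH(1), rule Disj.prems) auto
  moreover have "win C P F r s = win C P' F r s"
    by (rule Disj.IH(2), rule Disj.prems) auto
  ultimately show ?case by simp
qed auto

text \<open>The strategy need not change. If it wins through \<open>l\<close>, then \<open>l\<close>
  is true at the disjunction, and it stays true at every leaf of \<open>s'\<close> because it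
  ignores what \<open>s'\<close> binds.\<close>

lemma win_absorb:
  assumes "repl s s' A t A' t'" "wf_dtree (\<Gamma> \<union> A) t" "(\<Gamma> \<union> A) \<inter> B = {}" "bound t \<subseteq> B"
    "leaf_insens B t P" and s: "s = Disj l s' \<or> s = Disj s' l" and F: "\<forall>u \<tau>. F u \<tau> \<in> C"
    and "win C P F t \<sigma>"
  shows "win C (absorbed C P l s') F t' \<sigma>"
  using assms(1-5,8)
proof (induction arbitrary: B \<sigma>)
  case (repl_here A)
  have ins: "insens B (skolem_sat C P l)"
    by (rule insens_skolem_sat[of B l P "\<Gamma> \<union> A"]) (use repl_here s in auto)
  have bs: "bound s' \<subseteq> B" using repl_here s by auto
  have "win C P F l \<sigma> \<or> win C P F s' \<sigma>" using repl_here s by auto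
  then show ?case
  proof
    assume "win C P F l \<sigma>"
    then have sk: "skolem_sat C P l \<sigma>" using F unfolding skolem_sat_def by blast
    show ?thesis
    proof (rule win_if_all_leaves)
      fix g \<sigma>' assume "g \<in> leaves s'" and e: "\<forall>x. x \<notin> bound s' \<longrightarrow> \<sigma> x = \<sigma>' x"
      have "\<forall>x. x \<notin> B \<longrightarrow> \<sigma> x = \<sigma>' x" using e bs by blast
      then have "skolem_sat C P l \<sigma>'" using ins sk unfolding insens_def by blast
      with \<open>g \<in> leaves s'\<close> show "absorbed C P l s' g \<sigma>'" by (simp add: absorbed_def)
    qed
  next
    assume "win C P F s' \<sigma>"
    then show ?thesis by (rule win_mono[rotated]) (simp add: absorbed_def)
  qed
next
  case (repl_Al x A t A' t')
  have "win C (absorbed C P l s') F t' (\<sigma>(x := a))" if "a \<in> C" for a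
    by (rule repl_Al.IH[of "B - {x}"]) (use repl_Al.prems that in \<open>auto simp del: fun_upd_apply\<close>)
  then show ?case by simp
next
  case (repl_Ex A t A' t' u D)
  have "win C (absorbed C P l s') F t' (\<sigma>(u := F u (restr \<sigma> D)))"
    by (rule repl_Ex.IH[of "B - {u}"]) (use repl_Ex.prems in \<open>auto simp del: fun_upd_apply\<close>)
  then show ?case by simp
next
  case (repl_left A l0 A' l' r)
  have "win C P F r \<sigma> \<Longrightarrow> win C (absorbed C P l s') F r \<sigma>"
    by (erule win_mono[rotated]) (simp add: absorbed_def)
  then show ?case using repl_left.IH[of B \<sigma>] repl_left.prems by auto
next
  case (repl_right A r A' r' l0)
  have "win C P F l0 \<sigma> \<Longrightarrow> win C (absorbed C P l s') F l0 \<sigma>"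
    by (erule win_mono[rotated]) (simp add: absorbed_def)
  then show ?case using repl_right.IH[of B \<sigma>] repl_right.prems by auto
qed

text \<open>The function \<open>h\<close> expresses that the states reached under a fixed strategy are determined by the
  values of the universal variables passed so far.\<close>

lemma win_unabsorb:
  assumes "repl s s' A t A' t'" "wf_dtree (\<Gamma> \<union> A) t" "(\<Gamma> \<union> A) \<inter> B = {}" "bound t \<subseteq> B"
    "leaf_insens B t P" and s: "s = Disj l s' \<or> s = Disj s' l" and F: "\<forall>u \<tau>. F u \<tau> \<in> C"
    and A': "\<forall>D\<in>deps l. A' \<subseteq> D"
  shows "\<exists>F'. (\<forall>u \<tau>. F' u \<tau> \<in> C) \<and> (\<forall>u. u \<notin> bound l \<longrightarrow> F' u = F u) \<and>
    (\<forall>\<sigma>. \<sigma> = h (restr \<sigma> A) \<longrightarrow> win C (absorbed C P l s') F t' \<sigma> \<longrightarrow> win C P F' t \<sigma>)"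
  using assms(1-5) A'
proof (induction arbitrary: B h)
  case (repl_here A)
  have ins: "insens B (skolem_sat C P l)"
    by (rule insens_skolem_sat[of B l P "\<Gamma> \<union> A"]) (use repl_here s in auto)
  have bs: "bound s' \<subseteq> B" "bound l \<inter> bound s' = {}" "bound l \<subseteq> B" using repl_here s by auto
  have "\<forall>\<sigma>. \<exists>G. (\<forall>u \<tau>. G u \<tau> \<in> C) \<and> (skolem_sat C P l \<sigma> \<longrightarrow> win C P G l \<sigma>)"
    using F unfolding skolem_sat_def by blast
  then obtain G where G: "\<And>\<sigma> u \<tau>. G \<sigma> u \<tau> \<in> C" "\<And>\<sigma>. skolem_sat C P l \<sigma> \<Longrightarrow> win C P (G \<sigma>) l \<sigma>"
    by metis
  \<comment> \<open>A Skolem function of \<open>l\<close> sees all of \<open>A\<close>, so from its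
    argument it recovers the state at the disjunction by means of \<open>h\<close> and follows the
    strategy \<open>G\<close> chosen for that state.\<close>
  define F' where "F' u \<tau> = (if u \<in> bound l then G (h (restr \<tau> A)) u \<tau> else F u \<tau>)" for u \<tau>
  have "win C P F' s \<sigma>" if \<sigma>: "\<sigma> = h (restr \<sigma> A)" and w: "win C (absorbed C P l s') F s' \<sigma>" for \<sigma>
  proof (cases "skolem_sat C P l \<sigma>")
    case True
    have "win C P F' l \<sigma> = win C P (G \<sigma>) l \<sigma>"
    proof (rule win_cong_on[where A = A])
      show "F' u \<tau> = G \<sigma> u \<tau>" if "u \<in> bound l" "restr \<tau> A = restr \<sigma> A" for u \<tau>
        using that \<sigma> by (simp add: F'_def)
      show "\<forall>D\<in>deps l. A \<subseteq> D" using repl_here by blast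
      show "A \<inter> bound l = {}" using repl_here bs by blast
    qed
    then show ?thesis using G(2)[OF True] s by auto
  next
    case False
    \<comment> \<open>\<open>l\<close> fails here, hence also at every state reachable inside
      \<open>s'\<close>, so absorption has added nothing.\<close>
    have "win C (absorbed C P l s') F s' \<sigma> = win C P F s' \<sigma>"
    proof (rule win_cong_reach)
      fix g \<sigma>' assume e: "\<forall>x. x \<notin> bound s' \<longrightarrow> \<sigma> x = \<sigma>' x"
      then have "\<forall>x. x \<notin> B \<longrightarrow> \<sigma> x = \<sigma>' x" using bs by blast
      then have "\<not> skolem_sat C P l \<sigma>'" using ins False unfolding insens_def by blast
      then show "absorbed C P l s' g \<sigma>' = P g \<sigma>'" by (simp add: absorbed_def)
    qed
    also have "\<dots> = win C P F' s' \<sigma>"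
      by (rule win_cong) (use bs in \<open>auto simp: F'_def fun_eq_iff\<close>)
    finally have "win C (absorbed C P l s') F s' \<sigma> = win C P F' s' \<sigma>" .
    then show ?thesis using w s by auto
  qed
  moreover have "\<forall>u \<tau>. F' u \<tau> \<in> C" using F G by (simp add: F'_def)
  moreover have "\<forall>u. u \<notin> bound l \<longrightarrow> F' u = F u" by (simp add: F'_def fun_eq_iff)
  ultimately show ?case by blast
next
  case (repl_Al x A t A' t')
  \<comment> \<open>The state below is the one above with \<open>x\<close> set; the value of
    \<open>x\<close> is now among those that \<open>h\<close> may read.\<close>
  have "\<exists>F'. (\<forall>u \<tau>. F' u \<tau> \<in> C) \<and> (\<forall>u. u \<notin> bound l \<longrightarrow> F' u = F u) \<and>
    (\<forall>\<sigma>. \<sigma> = ((h (restr (restr \<sigma> (insert x A)) A))(x := restr \<sigma> (insert x A) x)) \<longrightarrow> win C (absorbed C P l s') F t' \<sigma> \<longrightarrow> win C P F' t \<sigma>)"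
    by (rule repl_Al.IH[of "B - {x}" "\<lambda>\<tau>. (h (restr \<tau> A))(x := \<tau> x)"]) (use repl_Al.prems in auto)
  then obtain F' where F': "\<forall>u \<tau>. F' u \<tau> \<in> C" "\<forall>u. u \<notin> bound l \<longrightarrow> F' u = F u"
    "\<And>\<sigma>. \<sigma> = (h (restr (restr \<sigma> (insert x A)) A))(x := restr \<sigma> (insert x A) x) \<Longrightarrow>
       win C (absorbed C P l s') F t' \<sigma> \<Longrightarrow> win C P F' t \<sigma>" by blast
  have xA: "x \<notin> A" using repl_Al.prems by auto
  have "win C P F' t (\<sigma>(x := a))" if "\<sigma> = h (restr \<sigma> A)" "win C (absorbed C P l s') F t' (\<sigma>(x := a))" for \<sigma> a
  proof (rule F'(3)[OF _ that(2)])
    have "restr (\<sigma>(x := a)) (insert x A) x = a" by (simp add: restr_def)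
    moreover have "restr (restr (\<sigma>(x := a)) (insert x A)) A = restr \<sigma> A"
      using xA by (simp add: restr_restr subset_insertI)
    ultimately show "\<sigma>(x := a) = (h (restr (restr (\<sigma>(x := a)) (insert x A)) A))(x := restr (\<sigma>(x := a)) (insert x A) x)"
      using that(1) by simp
  qed
  then show ?case using F'(1,2) by (intro exI[of _ F']) simp
next
  case (repl_Ex A t A' t' u D)
  \<comment> \<open>The value of an existential variable above the disjunction is computed by
    \<open>F\<close> from the state, so it adds nothing to what \<open>h\<close> must read.\<close>
  define h' where "h' = (\<lambda>\<tau>. (h \<tau>)(u := F u (restr (h \<tau>) D)))"
  have "\<exists>F'. (\<forall>u \<tau>. F' u \<tau> \<in> C) \<and> (\<forall>u. u \<notin> bound l \<longrightarrow> F' u = F u) \<and>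
    (\<forall>\<sigma>. \<sigma> = h' (restr \<sigma> A) \<longrightarrow> win C (absorbed C P l s') F t' \<sigma> \<longrightarrow> win C P F' t \<sigma>)"
    by (rule repl_Ex.IH[of "B - {u}" h']) (use repl_Ex.prems in auto)
  then obtain F' where F': "\<forall>u \<tau>. F' u \<tau> \<in> C" "\<forall>u. u \<notin> bound l \<longrightarrow> F' u = F u"
    "\<And>\<sigma>. \<sigma> = h' (restr \<sigma> A) \<Longrightarrow> win C (absorbed C P l s') F t' \<sigma> \<Longrightarrow> win C P F' t \<sigma>" by blast
  have uA: "u \<notin> A" using repl_Ex.prems by auto
  have "bound l \<subseteq> bound t" using repl_bound[OF repl_Ex.hyps] s by auto
  \<comment> \<open>Only Skolem functions inside \<open>l\<close> have been replaced, so the move at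
    \<open>u\<close>, on which \<open>h'\<close> relies, is still the one made by
    \<open>F\<close>.\<close>
  then have Fu: "F' u = F u" using F'(2) repl_Ex.prems(1) by auto
  have "win C P F' t (\<sigma>(u := F u (restr \<sigma> D)))"
    if \<sigma>: "\<sigma> = h (restr \<sigma> A)" and w: "win C (absorbed C P l s') F t' (\<sigma>(u := F u (restr \<sigma> D)))" for \<sigma>
  proof (rule F'(3)[OF _ w])
    show "\<sigma>(u := F u (restr \<sigma> D)) = h' (restr (\<sigma>(u := F u (restr \<sigma> D))) A)"
      using \<sigma> uA by (simp add: h'_def)
  qed
  then show ?case using F'(1,2) Fu by (intro exI[of _ F']) simp
next
  case (repl_left A l0 A' l' r)
  have "\<exists>F'. (\<forall>u \<tau>. F' u \<tau> \<in> C) \<and> (\<forall>u. u \<notin> bound l \<longrightarrow> F' u = F u) \<and>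
    (\<forall>\<sigma>. \<sigma> = h (restr \<sigma> A) \<longrightarrow> win C (absorbed C P l s') F l' \<sigma> \<longrightarrow> win C P F' l0 \<sigma>)"
    by (rule repl_left.IH[of B]) (use repl_left.prems in auto)
  then obtain F' where F': "\<forall>u \<tau>. F' u \<tau> \<in> C" "\<forall>u. u \<notin> bound l \<longrightarrow> F' u = F u"
    "\<And>\<sigma>. \<sigma> = h (restr \<sigma> A) \<Longrightarrow> win C (absorbed C P l s') F l' \<sigma> \<Longrightarrow> win C P F' l0 \<sigma>" by blast
  have "win C (absorbed C P l s') F r \<sigma> = win C P F' r \<sigma>" for \<sigma>
  proof (rule win_cong)
    show "absorbed C P l s' g = P g" if "g \<in> leaves r" for g
      by (rule absorbed_off) (use that repl_leaves[OF repl_left.hyps] repl_left.prems s in auto)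
    show "F u = F' u" if "u \<in> bound r" for u
    proof -
      have "u \<notin> bound l" using that repl_bound[OF repl_left.hyps] repl_left.prems(1) s by auto
      then show ?thesis using F'(2) by simp
    qed
  qed
  then show ?case using F' by (intro exI[of _ F']) auto
next
  case (repl_right A r A' r' l0)
  have "\<exists>F'. (\<forall>u \<tau>. F' u \<tau> \<in> C) \<and> (\<forall>u. u \<notin> bound l \<longrightarrow> F' u = F u) \<and>
    (\<forall>\<sigma>. \<sigma> = h (restr \<sigma> A) \<longrightarrow> win C (absorbed C P l s') F r' \<sigma> \<longrightarrow> win C P F' r \<sigma>)"
    by (rule repl_right.IH[of B]) (use repl_right.prems in auto)
  then obtain F' where F': "\<forall>u \<tau>. F' u \<tau> \<in> C" "\<forall>u. u \<notin> bound l \<longrightarrow> F' u = F u"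
    "\<And>\<sigma>. \<sigma> = h (restr \<sigma> A) \<Longrightarrow> win C (absorbed C P l s') F r' \<sigma> \<Longrightarrow> win C P F' r \<sigma>" by blast
  have "win C (absorbed C P l s') F l0 \<sigma> = win C P F' l0 \<sigma>" for \<sigma>
  proof (rule win_cong)
    show "absorbed C P l s' g = P g" if "g \<in> leaves l0" for g
      by (rule absorbed_off) (use that repl_leaves[OF repl_right.hyps] repl_right.prems s in auto)
    show "F u = F' u" if "u \<in> bound l0" for u
    proof -
      have "u \<notin> bound l" using that repl_bound[OF repl_right.hyps] repl_right.prems(1) s by auto
      then show ?thesis using F'(2) by simp
    qed
  qed
  then show ?case using F' by (intro exI[of _ F']) auto
qed


lemma skolem_sat_absorb:
  assumes "repl s s' {} t A' t'" "wf_dtree \<Gamma> t" "\<Gamma> \<inter> B = {}" "bound t \<subseteq> B"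
    "leaf_insens B t P" and s: "s = Disj l s' \<or> s = Disj s' l" and A': "\<forall>D\<in>deps l. A' \<subseteq> D"
  shows "skolem_sat C P t \<sigma> \<longleftrightarrow> skolem_sat C (absorbed C P l s') t' \<sigma>"
proof
  assume "skolem_sat C P t \<sigma>"
  then obtain F where F: "\<forall>u \<tau>. F u \<tau> \<in> C" "win C P F t \<sigma>" unfolding skolem_sat_def by blast
  have "win C (absorbed C P l s') F t' \<sigma>"
    by (rule win_absorb[of s s' "{}" t A' t' \<Gamma> B]) (use assms F in auto)
  then show "skolem_sat C (absorbed C P l s') t' \<sigma>"
    using F(1) unfolding skolem_sat_def by blast
next
  assume "skolem_sat C (absorbed C P l s') t' \<sigma>"
  then obtain F where F: "\<forall>u \<tau>. F u \<tau> \<in> C" "win C (absorbed C P l s') F t' \<sigma>"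
    unfolding skolem_sat_def by blast
  \<comment> \<open>No universal variable has been passed at the root, so the recovering function is
    the constant \<open>\<sigma>\<close>.\<close>
  have "\<exists>F'. (\<forall>u \<tau>. F' u \<tau> \<in> C) \<and> (\<forall>u. u \<notin> bound l \<longrightarrow> F' u = F u) \<and>
    (\<forall>\<sigma>'. \<sigma>' = (\<lambda>_. \<sigma>) (restr \<sigma>' {}) \<longrightarrow> win C (absorbed C P l s') F t' \<sigma>' \<longrightarrow> win C P F' t \<sigma>')"
    by (rule win_unabsorb[of s s' "{}" t A' t' \<Gamma> B]) (use assms F in auto)
  then obtain F' where F': "\<forall>u \<tau>. F' u \<tau> \<in> C" "win C P F' t \<sigma>" using F(2) by blast
  then show "skolem_sat C P t \<sigma>" unfolding skolem_sat_def by blast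
qed

section \<open>Reading off a first-order tree\<close>

primrec fo_eval :: "'a set \<Rightarrow> ('g \<Rightarrow> (nat \<Rightarrow> 'a) \<Rightarrow> bool) \<Rightarrow> 'g tree \<Rightarrow> (nat \<Rightarrow> 'a) \<Rightarrow> bool" where
  "fo_eval C P (Leaf g) s = P g s"
| "fo_eval C P (Quant Q v V t) s = (case Q of
      Forall \<Rightarrow> \<forall>a\<in>C. fo_eval C P t (s(v := a))
    | Exists \<Rightarrow> \<exists>a\<in>C. fo_eval C P t (s(v := a)))"
| "fo_eval C P (Conn c l r) s = (case c of
      And \<Rightarrow> fo_eval C P l s \<and> fo_eval C P r s
    | Or \<Rightarrow> fo_eval C P l s \<or> fo_eval C P r s)"

primrec graft :: "('g \<Rightarrow> 'h tree) \<Rightarrow> 'g tree \<Rightarrow> 'h tree" where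
  "graft f (Leaf g) = f g"
| "graft f (Quant Q v V t) = Quant Q v V (graft f t)"
| "graft f (Conn c l r) = Conn c (graft f l) (graft f r)"

lemma fo_eval_graft: "fo_eval C P (graft f S) s = fo_eval C (\<lambda>g. fo_eval C P (f g)) S s"
  by (induction S arbitrary: s) (auto split: quantifier.split connective.split simp del: fun_upd_apply)

lemma first_order_graft:
  "first_order_tree S \<Longrightarrow> (\<And>g. first_order_tree (f g)) \<Longrightarrow> first_order_tree (graft f S)"
  by (induction S) auto

lemma set_graft: "set_tree (graft f S) = (\<Union>g\<in>set_tree S. set_tree (f g))"
  by (induction S) auto

text \<open>\<open>S\<close> is chosen before \<open>C\<close>, \<open>P\<close> and
  \<open>s\<close>, so one tree serves all completions. Quantifying over all predicates
  \<open>P\<close> makes the induction hypothesis usable after an absorption, where the leaves of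
  the smaller tree are judged by \<open>absorbed\<close>.\<close>

lemma first_order_reading:
  assumes "wf_dtree \<Gamma> t" "\<Gamma> \<inter> bound t = {}" "tame \<Gamma> {} t"
  shows "\<exists>S. first_order_tree S \<and> set_tree S \<subseteq> leaves t \<and> (\<forall>(C :: 'a set) P s. C \<noteq> {} \<longrightarrow> leaf_insens (bound t) t P \<longrightarrow>
    fo_eval C P S s = skolem_sat C P t s)"
  using assms
proof (induction "nodes t" arbitrary: \<Gamma> t rule: less_induct)
  case less
  note IH = less.hyps
  show ?case
  proof (cases rule: pull_or_absorb[OF less.prems, case_names leaf univ ex absorb])
    case (leaf g)
    have "fo_eval C P (Leaf g) s = skolem_sat C P t s" if C: "C \<noteq> {}" for C :: "'a set" and P s
    proof -
      obtain c where "c \<in> C" using C by blast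
      then show ?thesis unfolding leaf skolem_sat_def by (auto intro: exI[of _ "\<lambda>_ _. c"])
    qed
    then show ?thesis by (intro exI[of _ "Leaf g"]) (simp add: leaf)
  next
    case (univ x)
    have x: "x \<in> bound t" using univ(1) univs_subset_bound by blast
    have bd: "bound (del x t) = bound t - {x}" using bound_del less.prems(1) by blast
    have dj: "insert x \<Gamma> \<inter> bound (del x t) = {}" using less.prems(2) bd by blast
    obtain S where S: "first_order_tree S" "set_tree S \<subseteq> leaves (del x t)" "\<And>(C :: 'a set) P s. C \<noteq> {} \<Longrightarrow>
        leaf_insens (bound (del x t)) (del x t) P \<Longrightarrow> fo_eval C P S s = skolem_sat C P (del x t) s"
      using IH[OF nodes_del(2)[OF x] wf_del[OF less.prems(1)] dj tame_del[OF less.prems(3)]] by blast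
    have "fo_eval C P (Quant Forall x {||} S) s = skolem_sat C P t s"
      if C: "C \<noteq> {}" and P: "leaf_insens (bound t) t P" for C :: "'a set" and P s
    proof -
      have "leaf_insens (bound (del x t)) (del x t) P" unfolding bd by (rule leaf_insens_del[OF P])
      then show ?thesis
        using skolem_sat_del_univ[OF C P less.prems(1,2) order_refl univ] S(3)[OF C]
        by (simp del: fun_upd_apply)
    qed
    then show ?thesis using S(1,2) by (intro exI[of _ "Quant Forall x {||} S"]) simp
  next
    case (ex w D)
    have w: "w \<in> bound t" using ex(1) by (rule exs_bound)
    have nw: "w \<notin> univs t" by (rule exs_not_univ[OF less.prems(1) ex(1)])
    have bd: "bound (del w t) = bound t - {w}" using bound_del less.prems(1) by blast
    have dj: "D \<inter> bound t = {}" using ex(2) less.prems(2) by blast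
    have dj': "\<Gamma> \<inter> bound (del w t) = {}" using less.prems(2) bd by blast
    obtain S where S: "first_order_tree S" "set_tree S \<subseteq> leaves (del w t)" "\<And>(C :: 'a set) P s. C \<noteq> {} \<Longrightarrow>
        leaf_insens (bound (del w t)) (del w t) P \<Longrightarrow> fo_eval C P S s = skolem_sat C P (del w t) s"
      using IH[OF nodes_del(2)[OF w] wf_del_ex[OF less.prems(1) nw] dj' tame_del_ex[OF less.prems(3) nw]]
      by blast
    have "fo_eval C P (Quant Exists w {||} S) s = skolem_sat C P t s"
      if C: "C \<noteq> {}" and P: "leaf_insens (bound t) t P" for C :: "'a set" and P s
    proof -
      have "leaf_insens (bound (del w t)) (del w t) P" unfolding bd by (rule leaf_insens_del[OF P])
      then show ?thesis
        using skolem_sat_del_ex[OF P less.prems(1,2) order_refl ex(1) dj] S(3)[OF C]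
        by (simp del: fun_upd_apply)
    qed
    then show ?thesis using S(1,2) by (intro exI[of _ "Quant Exists w {||} S"]) simp
  next
    case (absorb s l s' A' t')
    have site: "wf_dtree (\<Gamma> \<union> A') s" "(\<Gamma> \<union> A') \<inter> bound s = {}" "A' \<subseteq> univs t"
      "bound s \<subseteq> bound t" "nodes s \<le> nodes t" "tame \<Gamma> A' s"
      using repl_site[OF absorb(2), of \<Gamma>] repl_tame_site[OF absorb(2) less.prems(3)] less.prems by auto
    have res: "wf_dtree \<Gamma> t'" "tame \<Gamma> {} t'" "bound t' \<subseteq> bound t" "nodes t' < nodes t"
      "leaves t' \<subseteq> leaves t"
      using repl_result[OF absorb(2), of \<Gamma> l] absorb(1) less.prems by auto
    have "A' \<inter> \<Gamma> = {}" using site(3) univs_subset_bound[of t] less.prems(2) by blast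
    then have A': "\<forall>D\<in>deps l. A' \<subseteq> D" using absorb(3) by blast
    have l: "wf_dtree (\<Gamma> \<union> A') l" "(\<Gamma> \<union> A') \<inter> bound l = {}" "tame \<Gamma> A' l" "nodes l < nodes t"
      "bound l \<subseteq> bound t"
      using site absorb(1) nodes_pos[of s'] by auto
    \<comment> \<open>Seen from a single state at the disjunction, all universal variables above
      \<open>l\<close> are constants; they move from \<open>A\<close> into the context.\<close>
    have tl: "tame (\<Gamma> \<union> A') {} l" by (rule tame_mono[OF l(3)]) auto
    obtain Sl where Sl: "first_order_tree Sl" "set_tree Sl \<subseteq> leaves l" "\<And>(C :: 'a set) P s. C \<noteq> {} \<Longrightarrow>
        leaf_insens (bound l) l P \<Longrightarrow> fo_eval C P Sl s = skolem_sat C P l s"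
      using IH[OF l(4) l(1,2) tl] by blast
    have disj': "\<Gamma> \<inter> bound t' = {}" using res(3) less.prems(2) by blast
    obtain S where S: "first_order_tree S" "set_tree S \<subseteq> leaves t'" "\<And>(C :: 'a set) P s. C \<noteq> {} \<Longrightarrow>
        leaf_insens (bound t') t' P \<Longrightarrow> fo_eval C P S s = skolem_sat C P t' s"
      using IH[OF res(4) res(1) disj' res(2)] by blast
    \<comment> \<open>Each leaf of \<open>s'\<close> receives its own copy of the tree for
      \<open>l\<close> as an alternative, which is \<open>absorbed\<close> in syntactic
      form.\<close>
    define f where "f g = (if g \<in> leaves s' then Conn Or (Leaf g) Sl else Leaf g)" for g
    have "fo_eval C P (graft f S) \<sigma> = skolem_sat C P t \<sigma>"
      if C: "C \<noteq> {}" and P: "leaf_insens (bound t) t P" for C :: "'a set" and P \<sigma>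
    proof -
      have "leaf_insens (bound s) s P"
        by (rule leaf_insens_site[OF absorb(2) less.prems(1) P site(4)])
      then have "leaf_insens (bound l) s P"
        by (rule leaf_insens_mono) (use absorb(1) site(4) in auto)
      then have "leaf_insens (bound l) l P" using absorb(1) by auto
      then have "(\<lambda>g. fo_eval C P (f g)) = absorbed C P l s'"
        using Sl(3)[OF C] by (auto simp: f_def absorbed_def fun_eq_iff)
      then have "fo_eval C P (graft f S) \<sigma> = fo_eval C (absorbed C P l s') S \<sigma>"
        by (simp add: fo_eval_graft)
      also have "\<dots> = skolem_sat C (absorbed C P l s') t' \<sigma>"
      proof (rule S(3)[OF C])
        have "leaf_insens (bound t) t' (absorbed C P l s')"
          by (rule leaf_insens_absorbed[OF absorb(2) _ _ order_refl P absorb(1), of \<Gamma>])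
            (use less.prems in auto)
        then show "leaf_insens (bound t') t' (absorbed C P l s')"
          by (rule leaf_insens_mono) (rule res(3))
      qed
      also have "\<dots> = skolem_sat C P t \<sigma>"
        using skolem_sat_absorb[OF absorb(2) less.prems(1,2) order_refl P absorb(1) A'] by simp
      finally show ?thesis .
    qed
    moreover have "first_order_tree (graft f S)"
      by (rule first_order_graft[OF S(1)]) (simp add: f_def Sl(1))
    moreover have "set_tree (graft f S) \<subseteq> leaves t"
    proof -
      have "leaves l \<subseteq> leaves t" using repl_leaves[OF absorb(2)] absorb(1) by auto
      then have "set_tree (f g) \<subseteq> insert g (leaves t)" for g using Sl(2) by (auto simp: f_def)
      moreover have "set_tree S \<subseteq> leaves t" using S(2) res(5) by blast
      ultimately show ?thesis unfolding set_graft by blast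
    qed
    ultimately show ?thesis by blast
  qed
qed

section \<open>First-order formulas and renaming\<close>

primrec to_fo :: "if_formula \<Rightarrow> fo" where
  "to_fo (Leaf l) = (case l of PosLit a \<Rightarrow> FOAtom a | NegLit a \<Rightarrow> FONot (FOAtom a))"
| "to_fo (Quant Q v V t) = (case Q of Forall \<Rightarrow> FOAll v (to_fo t) | Exists \<Rightarrow> FOEx v (to_fo t))"
| "to_fo (Conn c l r) =
     (case c of And \<Rightarrow> FOAnd (to_fo l) (to_fo r) | Or \<Rightarrow> FOOr (to_fo l) (to_fo r))"

lemma uniform_empty: "uniform {} X F"
  unfolding uniform_def by (metis empty_iff ext)

text \<open>Flatness: with empty slash sets, choices may depend on the whole assignment, so they are
  made separately for each member of the team, and a disjunction splits the team by truth.\<close>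

lemma team_sat_first_order:
  "first_order_tree \<phi> \<Longrightarrow> team_sat M \<phi> X \<longleftrightarrow> (\<forall>s\<in>X. fo_sat M s (to_fo \<phi>))"
proof (induction \<phi> arbitrary: X)
  case (Leaf l)
  then show ?case by (cases l) auto
next
  case (Quant Q v V \<phi>)
  have ih: "team_sat M \<phi> Y \<longleftrightarrow> (\<forall>s\<in>Y. fo_sat M s (to_fo \<phi>))" for Y
    using Quant by auto
  show ?case
  proof (cases Q)
    case Forall
    then show ?thesis by (auto simp: ih simp del: fun_upd_apply)
  next
    case Exists
    have "team_sat M (Quant Q v V \<phi>) X \<longleftrightarrow>
      (\<exists>F. \<forall>s\<in>X. F s \<in> carrier M \<and> fo_sat M (s(v \<mapsto> F s)) (to_fo \<phi>))"
      using Quant.prems Exists uniform_empty[of X] by (simp add: ih) blast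
    also have "\<dots> \<longleftrightarrow> (\<forall>s\<in>X. \<exists>a. a \<in> carrier M \<and> fo_sat M (s(v \<mapsto> a)) (to_fo \<phi>))"
      by (rule bchoice_iff[symmetric])
    finally show ?thesis using Exists by (auto simp del: fun_upd_apply)
  qed
next
  case (Conn c l r)
  have ih: "team_sat M l Y \<longleftrightarrow> (\<forall>s\<in>Y. fo_sat M s (to_fo l))"
    "team_sat M r Y \<longleftrightarrow> (\<forall>s\<in>Y. fo_sat M s (to_fo r))" for Y
    using Conn by auto
  show ?case
  proof (cases c)
    case And
    then show ?thesis by (auto simp: ih)
  next
    case Or
    show ?thesis
    proof
      assume "team_sat M (Conn c l r) X"
      then show "\<forall>s\<in>X. fo_sat M s (to_fo (Conn c l r))" using Or by (auto simp: ih)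
    next
      assume *: "\<forall>s\<in>X. fo_sat M s (to_fo (Conn c l r))"
      have "X = {s\<in>X. fo_sat M s (to_fo l)} \<union> {s\<in>X. fo_sat M s (to_fo r)}"
        using * Or by auto
      then show "team_sat M (Conn c l r) X"
        unfolding Or team_sat.simps connective.case ih by blast
    qed
  qed
qed

lemma trm_val_cong: "(\<And>x. x \<in> trm_vars t \<Longrightarrow> s x = s' x) \<Longrightarrow> trm_val M s t = trm_val M s' t"
proof (induction t)
  case (Fun f ts)
  then have "map (trm_val M s) ts = map (trm_val M s') ts" by auto
  then show ?case by (simp only: trm_val.simps)
qed simp

lemma atom_holds_cong:
  assumes "\<And>x. x \<in> atom_vars a \<Longrightarrow> s x = s' x"
  shows "atom_holds M s a = atom_holds M s' a"
proof (cases a)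
  case (Eq t u)
  then show ?thesis using assms trm_val_cong[of t s s' M] trm_val_cong[of u s s' M] by simp
next
  case (Rel r ts)
  then have "map (trm_val M s) ts = map (trm_val M s') ts"
    using assms by (auto intro!: trm_val_cong)
  with Rel show ?thesis by (simp only: atom_holds.simps)
qed

lemma fo_sat_cong:
  "(\<And>x. x \<in> fo_free \<phi> \<Longrightarrow> s x = s' x) \<Longrightarrow> fo_sat M s \<phi> = fo_sat M s' \<phi>"
proof (induction \<phi> arbitrary: s s')
  case (FOAtom a)
  then show ?case using atom_holds_cong[of a s s' M] by simp
next
  case (FONot \<phi>)
  then show ?case by (metis fo_free.simps(2) fo_sat.simps(2))
next
  case (FOAnd \<phi> \<psi>)
  have "fo_sat M s \<phi> = fo_sat M s' \<phi>" "fo_sat M s \<psi> = fo_sat M s' \<psi>"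
    by (rule FOAnd.IH; use FOAnd.prems in simp)+
  then show ?case by simp
next
  case (FOOr \<phi> \<psi>)
  have "fo_sat M s \<phi> = fo_sat M s' \<phi>" "fo_sat M s \<psi> = fo_sat M s' \<psi>"
    by (rule FOOr.IH; use FOOr.prems in simp)+
  then show ?case by simp
next
  case (FOAll v \<phi>)
  have "fo_sat M (s(v \<mapsto> a)) \<phi> = fo_sat M (s'(v \<mapsto> a)) \<phi>" for a
    by (rule FOAll.IH) (use FOAll.prems in auto)
  then show ?case by (simp del: fun_upd_apply)
next
  case (FOEx v \<phi>)
  have "fo_sat M (s(v \<mapsto> a)) \<phi> = fo_sat M (s'(v \<mapsto> a)) \<phi>" for a
    by (rule FOEx.IH) (use FOEx.prems in auto)
  then show ?case by (simp del: fun_upd_apply)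
qed

lemma fo_over_to_fo: "formula_over \<sigma> \<phi> \<Longrightarrow> fo_over \<sigma> (to_fo \<phi>)"
  unfolding formula_over_def
  by (induction \<phi>) (auto split: literal.split quantifier.split connective.split)

lemma fo_free_to_fo: "first_order_tree \<phi> \<Longrightarrow> fo_free (to_fo \<phi>) = free_vars literal_vars \<phi>"
  by (induction \<phi>) (auto split: literal.split quantifier.split connective.split)

lemma first_order_if_quantifier_free: "quantifier_free \<phi> \<Longrightarrow> first_order_tree \<phi>"
  by (induction \<phi>) auto

lemma regular_if_quantifier_free: "quantifier_free \<phi> \<Longrightarrow> regular_formula \<phi>"
proof -
  assume qf: "quantifier_free \<phi>"
  then have "bound_vars \<phi> = {}" by (induction \<phi>) auto
  moreover have "no_requantification \<phi>" using qf by (induction \<phi>) auto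
  ultimately show ?thesis by (simp add: regular_formula_def)
qed

section \<open>Completions of first-order trees as first-order sentences\<close>

lemma first_order_completion:
  "first_order_tree T \<Longrightarrow> (\<And>g. is_path T g \<Longrightarrow> quantifier_free (e g)) \<Longrightarrow>
    first_order_tree (completion T e)"
proof (induction T arbitrary: e)
  case (Leaf l)
  then show ?case by (simp add: is_path_def first_order_if_quantifier_free)
next
  case (Quant Q v V T)
  have "quantifier_free (e (0 # g))" if "is_path T g" for g
    using that Quant.prems(2)[of "0 # g"] by (simp add: is_path_def)
  then show ?case using Quant by simp
next
  case (Conn c l r)
  have "quantifier_free (e (0 # g))" if "is_path l g" for g
    using that Conn.prems(2)[of "0 # g"] by (simp add: is_path_def)
  moreover have "quantifier_free (e (1 # g))" if "is_path r g" for g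
    using that Conn.prems(2)[of "1 # g"] by (simp add: is_path_def)
  ultimately show ?case using Conn by simp
qed

lemma formula_over_completion:
  "(\<And>g. is_path T g \<Longrightarrow> formula_over \<sigma> (e g)) \<Longrightarrow> formula_over \<sigma> (completion T e)"
proof (induction T arbitrary: e)
  case (Leaf l)
  then show ?case by (simp add: is_path_def)
next
  case (Quant Q v V T)
  have "formula_over \<sigma> (completion T (\<lambda>p. e (0 # p)))"
  proof (rule Quant.IH)
    show "formula_over \<sigma> (e (0 # g))" if "is_path T g" for g
      using that Quant.prems[of "0 # g"] by (simp add: is_path_def)
  qed
  then show ?case by (simp add: formula_over_def)
next
  case (Conn c l r)
  have "formula_over \<sigma> (completion l (\<lambda>p. e (0 # p)))"
  proof (rule Conn.IH)
    show "formula_over \<sigma> (e (0 # g))" if "is_path l g" for g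
      using that Conn.prems[of "0 # g"] by (simp add: is_path_def)
  qed
  moreover have "formula_over \<sigma> (completion r (\<lambda>p. e (1 # p)))"
  proof (rule Conn.IH)
    show "formula_over \<sigma> (e (1 # g))" if "is_path r g" for g
      using that Conn.prems[of "1 # g"] by (simp add: is_path_def)
  qed
  ultimately show ?case by (auto simp: formula_over_def)
qed

lemma path_bound_simps [simp]:
  "path_bound (Leaf u) [] = {}"
  "path_bound (Quant Q v V t) (0 # g) = insert v (path_bound t g)"
  "path_bound (Conn c l r) (0 # g) = path_bound l g"
  "path_bound (Conn c l r) (1 # g) = path_bound r g"
proof -
  show "path_bound (Leaf u) [] = {}" by (simp add: path_bound_def quant_at_def)
  have *: "path_bound T (i # g) = {v. \<exists>Q V. quant_at T [] Q v V} \<union>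
      {v. \<exists>p Q V. prefix p g \<and> quant_at T (i # p) Q v V}" for T i g
    unfolding path_bound_def by (auto simp: prefix_Cons)
  show "path_bound (Quant Q v V t) (0 # g) = insert v (path_bound t g)"
    unfolding * by (auto simp: path_bound_def quant_at_def)
  show "path_bound (Conn c l r) (0 # g) = path_bound l g"
    "path_bound (Conn c l r) (1 # g) = path_bound r g"
    unfolding * by (auto simp: path_bound_def quant_at_def)
qed

text \<open>\<open>W\<close> stands for the variables bound above the current subtree; a sentential
  completion is the case of empty \<open>W\<close>.\<close>

lemma free_vars_completion:
  "first_order_tree T \<Longrightarrow>
    (\<And>g. is_path T g \<Longrightarrow> free_vars literal_vars (e g) \<subseteq> path_bound T g \<union> W) \<Longrightarrow>
    free_vars literal_vars (completion T e) \<subseteq> W"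
proof (induction T arbitrary: e W)
  case (Leaf l)
  then show ?case using Leaf.prems(2)[of "[]"] by (simp add: is_path_def)
next
  case (Quant Q v V T)
  have "free_vars literal_vars (completion T (\<lambda>p. e (0 # p))) \<subseteq> insert v W"
  proof (rule Quant.IH)
    show "free_vars literal_vars (e (0 # g)) \<subseteq> path_bound T g \<union> insert v W" if "is_path T g" for g
      using that Quant.prems(2)[of "0 # g"] by (simp add: is_path_def)
  qed (use Quant.prems in simp)
  then show ?case using Quant.prems(1) by auto
next
  case (Conn c l r)
  have "free_vars literal_vars (completion l (\<lambda>p. e (0 # p))) \<subseteq> W"
  proof (rule Conn.IH)
    show "free_vars literal_vars (e (0 # g)) \<subseteq> path_bound l g \<union> W" if "is_path l g" for g
      using that Conn.prems(2)[of "0 # g"] by (simp add: is_path_def)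
  qed (use Conn.prems in simp)
  moreover have "free_vars literal_vars (completion r (\<lambda>p. e (1 # p))) \<subseteq> W"
  proof (rule Conn.IH)
    show "free_vars literal_vars (e (1 # g)) \<subseteq> path_bound r g \<union> W" if "is_path r g" for g
      using that Conn.prems(2)[of "1 # g"] path_bound_simps(4)[of c l r g] by (simp add: is_path_def)
  qed (use Conn.prems in simp)
  ultimately show ?case by simp
qed

lemma first_order_tree_in_FO:
  assumes "first_order_tree T"
  shows "in_FO T"
  unfolding in_FO_def
proof
  fix K assume "K \<in> model_classes T"
  then obtain \<sigma> e where e: "completing \<sigma> T e" "weak T e" "sentential T e"
    and K: "K = {M. finite_structure \<sigma> M \<and> models M (completion T e)}"
    unfolding model_classes_def by blast
  let ?\<phi> = "completion T e"
  have fo: "first_order_tree ?\<phi>"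
    using first_order_completion[OF assms] e(2) unfolding weak_def by blast
  have "fo_over \<sigma> (to_fo ?\<phi>)"
    using fo_over_to_fo[OF formula_over_completion] e(1) unfolding completing_def by blast
  moreover have "free_vars literal_vars ?\<phi> \<subseteq> {}"
    by (rule free_vars_completion[OF assms]) (use e(3) in \<open>auto simp: sentential_def\<close>)
  then have "fo_free (to_fo ?\<phi>) = {}" using fo_free_to_fo[OF fo] by simp
  moreover have "models M ?\<phi> \<longleftrightarrow> fo_sat M Map.empty (to_fo ?\<phi>)" for M :: "nat struc"
    unfolding models_def by (simp add: team_sat_first_order[OF fo])
  ultimately show "fo_definable K" unfolding fo_definable_def K by blast
qed

section \<open>Renaming variables in quantifier-free formulas\<close>

primrec ren_trm :: "(nat \<Rightarrow> nat) \<Rightarrow> trm \<Rightarrow> trm" where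
  "ren_trm \<rho> (Var x) = Var (\<rho> x)"
| "ren_trm \<rho> (Fun f ts) = Fun f (map (ren_trm \<rho>) ts)"

primrec ren_atom :: "(nat \<Rightarrow> nat) \<Rightarrow> atom \<Rightarrow> atom" where
  "ren_atom \<rho> (Eq t u) = Eq (ren_trm \<rho> t) (ren_trm \<rho> u)"
| "ren_atom \<rho> (Rel r ts) = Rel r (map (ren_trm \<rho>) ts)"

primrec ren_literal :: "(nat \<Rightarrow> nat) \<Rightarrow> literal \<Rightarrow> literal" where
  "ren_literal \<rho> (PosLit a) = PosLit (ren_atom \<rho> a)"
| "ren_literal \<rho> (NegLit a) = NegLit (ren_atom \<rho> a)"

lemma trm_vars_ren: "trm_vars (ren_trm \<rho> t) = \<rho> ` trm_vars t"
  by (induction t) auto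

lemma literal_vars_ren: "literal_vars (ren_literal \<rho> l) = \<rho> ` literal_vars l"
proof -
  have "atom_vars (ren_atom \<rho> a) = \<rho> ` atom_vars a" for a
    by (cases a) (auto simp: trm_vars_ren)
  then show ?thesis by (cases l) auto
qed

lemma trm_over_ren: "trm_over \<sigma> (ren_trm \<rho> t) = trm_over \<sigma> t"
  by (induction t) (auto simp: list_all_iff)

lemma literal_over_ren: "literal_over \<sigma> (ren_literal \<rho> l) = literal_over \<sigma> l"
proof -
  have "atom_over \<sigma> (ren_atom \<rho> a) = atom_over \<sigma> a" for a
    by (cases a) (auto simp: trm_over_ren list_all_iff)
  then show ?thesis by (cases l) auto
qed

lemma trm_val_ren:
  "(\<And>x. x \<in> trm_vars t \<Longrightarrow> s' (\<rho> x) = s x) \<Longrightarrow> trm_val M s' (ren_trm \<rho> t) = trm_val M s t"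
proof (induction t)
  case (Fun f ts)
  then have "map (trm_val M s' \<circ> ren_trm \<rho>) ts = map (trm_val M s) ts" by auto
  then show ?case by (simp only: trm_val.simps ren_trm.simps map_map)
qed simp

lemma atom_holds_ren:
  assumes "\<And>x. x \<in> atom_vars a \<Longrightarrow> s' (\<rho> x) = s x"
  shows "atom_holds M s' (ren_atom \<rho> a) = atom_holds M s a"
proof (cases a)
  case (Eq t u)
  then show ?thesis using assms trm_val_ren[of t s' \<rho> s M] trm_val_ren[of u s' \<rho> s M] by simp
next
  case (Rel r ts)
  then have "map (trm_val M s' \<circ> ren_trm \<rho>) ts = map (trm_val M s) ts"
    using assms by (auto intro!: trm_val_ren)
  with Rel show ?thesis by (simp only: atom_holds.simps ren_atom.simps map_map)
qed

lemma fo_sat_ren: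
  "quantifier_free \<phi> \<Longrightarrow> (\<And>x. x \<in> free_vars literal_vars \<phi> \<Longrightarrow> s' (\<rho> x) = s x) \<Longrightarrow>
    fo_sat M s' (to_fo (map_tree (ren_literal \<rho>) \<phi>)) = fo_sat M s (to_fo \<phi>)"
proof (induction \<phi>)
  case (Leaf l)
  then show ?case by (cases l) (simp_all add: atom_holds_ren)
qed (auto split: connective.split)

lemma quantifier_free_map [simp]: "quantifier_free (map_tree f \<phi>) = quantifier_free \<phi>"
  by (induction \<phi>) auto

lemma free_vars_ren:
  "quantifier_free \<phi> \<Longrightarrow>
    free_vars literal_vars (map_tree (ren_literal \<rho>) \<phi>) = \<rho> ` free_vars literal_vars \<phi>"
  by (induction \<phi>) (auto simp: literal_vars_ren)

lemma formula_over_ren: "formula_over \<sigma> (map_tree (ren_literal \<rho>) \<phi>) = formula_over \<sigma> \<phi>"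
  by (auto simp: formula_over_def tree.set_map literal_over_ren)

section \<open>The Skolem tree of an initial tree\<close>

lemma subtree_at_append:
  "subtree_at T (p @ q) = (case subtree_at T p of None \<Rightarrow> None | Some t \<Rightarrow> subtree_at t q)"
  by (induction T p rule: subtree_at.induct) auto

lemma subtree_at_bound_vars: "subtree_at T p = Some t \<Longrightarrow> bound_vars t \<subseteq> bound_vars T"
  by (induction T p rule: subtree_at.induct) (auto split: if_splits)

lemma subtree_at_no_requantification:
  "subtree_at T p = Some t \<Longrightarrow> no_requantification T \<Longrightarrow> no_requantification t"
  by (induction T p rule: subtree_at.induct) (auto split: if_splits)

lemma subtree_at_no_conjunctions:
  "subtree_at T p = Some t \<Longrightarrow> no_conjunctions T \<Longrightarrow> no_conjunctions t"
  by (induction T p rule: subtree_at.induct) (auto split: if_splits)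

lemma quant_at_fun: "quant_at T p Q v V \<Longrightarrow> quant_at T p Q' v' V' \<Longrightarrow> Q = Q' \<and> v = v' \<and> V = V'"
  by (auto simp: quant_at_def)

lemma exists_path: "subtree_at T p = Some t \<Longrightarrow> \<exists>g. is_path T g \<and> prefix p g"
proof (induction t arbitrary: p)
  case (Leaf u)
  then show ?case by (auto simp: is_path_def)
next
  case (Quant Q v V t)
  then have "subtree_at T (p @ [0]) = Some t" by (simp add: subtree_at_append)
  from Quant.IH[OF this] show ?case using append_prefixD by blast
next
  case (Conn c l r)
  then have "subtree_at T (p @ [0]) = Some l" by (simp add: subtree_at_append)
  from Conn.IH(1)[OF this] show ?case using append_prefixD by blast
qed

lemma strict_prefix_snoc: "strict_prefix q (p @ [i]) \<longleftrightarrow> prefix q p"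
  by (auto simp: strict_prefix_def)

lemma no_requantification_unique:
  assumes "no_requantification T" "quant_at T q Q v V" "strict_prefix q p" "quant_at T p Q' v' V'"
  shows "v \<noteq> v'"
proof -
  obtain t where t: "subtree_at T q = Some (Quant Q v V t)" using assms(2) by (auto simp: quant_at_def)
  obtain t' where t': "subtree_at T p = Some (Quant Q' v' V' t')" using assms(4) by (auto simp: quant_at_def)
  obtain i r where p: "p = q @ i # r" using assms(3) by (elim strict_prefixE')
  have "subtree_at t r = Some (Quant Q' v' V' t')"
    using t t' by (simp add: p subtree_at_append split: if_splits)
  then have "v' \<in> bound_vars t" using subtree_at_bound_vars by fastforce
  moreover have "v \<notin> bound_vars t" using subtree_at_no_requantification[OF t assms(1)] by simp
  ultimately show ?thesis by blast
qed

text \<open>Existential quantifiers are left out on purpose: without signalling, the values of those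
  that \<open>p\<close> depends on can be recomputed from the universal values listed here.\<close>

definition sees :: "pi_tree \<Rightarrow> nat list \<Rightarrow> nat set" where
  "sees T p = to_nat ` {q. forall_at T q \<and> depends T p q}"

definition univs_above :: "pi_tree \<Rightarrow> nat list \<Rightarrow> nat set" where
  "univs_above T p = to_nat ` {q. forall_at T q \<and> strict_prefix q p}"

text \<open>Variables are renamed to the (encoded) addresses of their quantifiers, since different branches
  may bind the same variable. \<open>p\<close> is the address of the current subtree in \<open>T\<close>.\<close>

primrec dtree_of :: "pi_tree \<Rightarrow> pi_tree \<Rightarrow> nat list \<Rightarrow> nat list dtree" where
  "dtree_of T (Leaf u) p = Lf p"
| "dtree_of T (Quant Q v V t) p = (case Q of
      Forall \<Rightarrow> Al (to_nat p) (dtree_of T t (p @ [0]))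
    | Exists \<Rightarrow> Exi (to_nat p) (sees T p) (dtree_of T t (p @ [0])))"
| "dtree_of T (Conn c l r) p = Disj (dtree_of T l (p @ [0])) (dtree_of T r (p @ [1]))"

lemma depends_strict_prefix: "depends T p q \<Longrightarrow> strict_prefix q p"
  by (simp add: depends_def)

lemma sees_subset_univs_above: "sees T p \<subseteq> univs_above T p"
  unfolding sees_def univs_above_def using depends_strict_prefix by blast

lemma mem_sees [simp]: "to_nat q \<in> sees T p \<longleftrightarrow> forall_at T q \<and> depends T p q"
  by (auto simp: sees_def)

lemma sees_subset_iff:
  "sees T p \<subseteq> sees T q \<longleftrightarrow> (\<forall>x. forall_at T x \<longrightarrow> depends T p x \<longrightarrow> depends T q x)"
  unfolding sees_def inj_image_subset_iff[OF inj_to_nat] by blast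

lemma univs_above_subset_iff:
  "univs_above T p \<subseteq> sees T q \<longleftrightarrow> (\<forall>x. forall_at T x \<longrightarrow> strict_prefix x p \<longrightarrow> depends T q x)"
  unfolding sees_def univs_above_def inj_image_subset_iff[OF inj_to_nat] by blast

lemma univs_above_forall: "quant_at T p Forall v V \<Longrightarrow> univs_above T (p @ [i]) = insert (to_nat p) (univs_above T p)"
  unfolding univs_above_def forall_at_def strict_prefix_snoc by (auto simp: strict_prefix_def)

lemma univs_above_other: "\<not> forall_at T p \<Longrightarrow> univs_above T (p @ [i]) = univs_above T p"
  unfolding univs_above_def strict_prefix_snoc by (auto simp: strict_prefix_def)

lemma leaves_dtree_of:
  "subtree_at T p = Some t \<Longrightarrow> g \<in> leaves (dtree_of T t p) \<Longrightarrow> is_path T g \<and> prefix p g"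
proof (induction t arbitrary: p)
  case (Leaf u)
  then show ?case by (simp add: is_path_def)
next
  case (Quant Q v V t)
  then have "subtree_at T (p @ [0]) = Some t" by (simp add: subtree_at_append)
  from Quant.IH[OF this] show ?case using Quant.prems(2) append_prefixD
    by (cases Q) auto
next
  case (Conn c l r)
  then have "subtree_at T (p @ [0]) = Some l" "subtree_at T (p @ [1]) = Some r"
    by (simp_all add: subtree_at_append)
  then show ?case using Conn.IH Conn.prems(2) append_prefixD by fastforce
qed

lemma bound_dtree_of: "x \<in> bound (dtree_of T t p) \<Longrightarrow> \<exists>q. x = to_nat q \<and> prefix p q"
proof (induction t arbitrary: p)
  case (Quant Q v V t)
  have "x = to_nat p \<or> x \<in> bound (dtree_of T t (p @ [0]))"
    using Quant.prems by (cases Q) auto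
  then show ?case using Quant.IH append_prefixD by blast
next
  case (Conn c l r)
  then have "x \<in> bound (dtree_of T l (p @ [0])) \<or> x \<in> bound (dtree_of T r (p @ [1]))" by simp
  then show ?case using Conn.IH append_prefixD by blast
qed simp

lemma bound_dtree_of_quant:
  "quant_at t r Q v V \<Longrightarrow> to_nat (p @ r) \<in> bound (dtree_of T t p)"
proof (induction t arbitrary: p r)
  case (Leaf u)
  then show ?case by (cases r) (auto simp: quant_at_def)
next
  case (Quant Q' v' V' t)
  show ?case
  proof (cases r)
    case Nil
    then show ?thesis by (cases Q') auto
  next
    case (Cons i r')
    then have "i = 0" "quant_at t r' Q v V"
      using Quant.prems by (auto simp: quant_at_def split: if_splits)
    then show ?thesis using Quant.IH[of r' "p @ [0]"] Cons by (cases Q') auto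
  qed
next
  case (Conn c l r0)
  obtain i r' where r: "r = i # r'" using Conn.prems by (cases r) (auto simp: quant_at_def)
  then have "i = 0 \<and> quant_at l r' Q v V \<or> i = 1 \<and> quant_at r0 r' Q v V"
    using Conn.prems by (auto simp: quant_at_def split: if_splits)
  then show ?case using Conn.IH(1)[of r' "p @ [0]"] Conn.IH(2)[of r' "p @ [1]"] r by auto
qed

lemma deps_dtree_of:
  "subtree_at T p = Some t \<Longrightarrow> D \<in> deps (dtree_of T t p) \<Longrightarrow>
    \<exists>q. D = sees T q \<and> exists_at T q \<and> prefix p q"
proof (induction t arbitrary: p)
  case (Quant Q v V t)
  then have sub: "subtree_at T (p @ [0]) = Some t" by (simp add: subtree_at_append)
  have "D \<in> deps (dtree_of T t (p @ [0])) \<or> Q = Exists \<and> D = sees T p"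
    using Quant.prems(2) by (cases Q) auto
  then show ?case
  proof
    assume "D \<in> deps (dtree_of T t (p @ [0]))"
    from Quant.IH[OF sub this] show ?thesis using append_prefixD by blast
  next
    assume "Q = Exists \<and> D = sees T p"
    then show ?thesis using Quant.prems(1) by (auto simp: exists_at_def quant_at_def)
  qed
next
  case (Conn c l r)
  then have sub: "subtree_at T (p @ [0]) = Some l" "subtree_at T (p @ [1]) = Some r"
    by (simp_all add: subtree_at_append)
  have "D \<in> deps (dtree_of T l (p @ [0])) \<or> D \<in> deps (dtree_of T r (p @ [1]))"
    using Conn.prems(2) by simp
  then show ?case using Conn.IH sub append_prefixD by blast
qed simp

lemma wf_dtree_of: "subtree_at T p = Some t \<Longrightarrow> wf_dtree (univs_above T p) (dtree_of T t p)"
proof (induction t arbitrary: p)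
  case (Quant Q v V t)
  then have sub: "subtree_at T (p @ [0]) = Some t" by (simp add: subtree_at_append)
  have nb: "to_nat p \<notin> bound (dtree_of T t (p @ [0]))"
    using bound_dtree_of[of "to_nat p" T t "p @ [0]"] by auto
  have q: "quant_at T p Q v V" using Quant.prems by (simp add: quant_at_def)
  show ?case
  proof (cases Q)
    case Forall
    then show ?thesis using Quant.IH[OF sub] nb univs_above_forall q by simp
  next
    case Exists
    then have "\<not> forall_at T p" using q quant_at_fun unfolding forall_at_def by blast
    then show ?thesis using Quant.IH[OF sub] nb univs_above_other[of T p 0] Exists sees_subset_univs_above by simp
  qed
next
  case (Conn c l r)
  then have sub: "subtree_at T (p @ [0]) = Some l" "subtree_at T (p @ [1]) = Some r"
    by (simp_all add: subtree_at_append)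
  have ab: "univs_above T (p @ [i]) = univs_above T p" for i
    by (rule univs_above_other) (use Conn.prems in \<open>auto simp: forall_at_def quant_at_def\<close>)
  have inc: "\<not> (prefix (p @ [0]) q \<and> prefix (p @ [1 :: nat]) q)" for q
    by (auto simp: prefix_def)
  have "bound (dtree_of T l (p @ [0])) \<inter> bound (dtree_of T r (p @ [1])) = {}"
    using bound_dtree_of[of _ T l "p @ [0]"] bound_dtree_of[of _ T r "p @ [1]"] inc
    by (metis (no_types, lifting) disjoint_iff to_nat_split)
  moreover have "leaves (dtree_of T l (p @ [0])) \<inter> leaves (dtree_of T r (p @ [1])) = {}"
    using leaves_dtree_of[OF sub(1)] leaves_dtree_of[OF sub(2)] inc by blast
  ultimately show ?case using Conn.IH(1)[OF sub(1)] Conn.IH(2)[OF sub(2)] unfolding ab by simp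
qed simp

text \<open>Let \<open>p\<close> see \<open>x\<close> but not \<open>z\<close>, and \<open>q\<close>
  see \<open>z\<close> but not \<open>x\<close>. If \<open>q\<close> depended on \<open>p\<close>,
  then \<open>x\<close>, \<open>p\<close>, \<open>q\<close> would signal; if not, \<open>x\<close>,
  \<open>p\<close>, \<open>z\<close>, \<open>q\<close> form a Henkin pattern, as \<open>p\<close>
  lies above \<open>q\<close> and cannot depend on it.\<close>

lemma comparable_on_path:
  assumes "\<not> henkin T" "\<not> signalling T" "strict_prefix p q" "exists_at T p" "exists_at T q"
  shows "comparable {} (sees T p) (sees T q)"
proof (rule ccontr)
  assume "\<not> comparable {} (sees T p) (sees T q)"
  then obtain x z where x: "forall_at T x" "depends T p x" "\<not> depends T q x"
    and z: "forall_at T z" "depends T q z" "\<not> depends T p z"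
    unfolding comparable_def Un_empty_right sees_subset_iff by blast
  obtain t where "subtree_at T q = Some t" using assms(5) by (auto simp: exists_at_def quant_at_def)
  then obtain g where g: "is_path T g" "prefix q g" using exists_path by blast
  have pre: "prefix p g" "prefix x g" "prefix z g"
    using g(2) assms(3) depends_strict_prefix[OF x(2)] depends_strict_prefix[OF z(2)]
    by (meson prefix_order.dual_order.trans strict_prefix_def)+
  have "\<not> depends T q p"
    using assms(2) x pre g assms(4,5) unfolding signalling_def signalling_path_def by blast
  moreover have "\<not> depends T p q"
    using depends_strict_prefix[of T p q] assms(3) by auto
  ultimately show False
    using assms(1) x z pre g assms(4,5) unfolding henkin_def henkin_path_def by blast
qed

text \<open>A universal quantifier seen by \<open>p\<close> but not by \<open>q\<close> would be
  signalled to \<open>q\<close> through \<open>p\<close>.\<close>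

lemma sees_mono_depends:
  assumes "\<not> signalling T" "exists_at T p" "exists_at T q" "depends T q p"
  shows "sees T p \<subseteq> sees T q"
proof -
  have "depends T q x" if x: "forall_at T x" "depends T p x" for x
  proof (rule ccontr)
    assume n: "\<not> depends T q x"
    obtain t where "subtree_at T q = Some t" using assms(3) by (auto simp: exists_at_def quant_at_def)
    then obtain g where g: "is_path T g" "prefix q g" using exists_path by blast
    have pre: "prefix p g" "prefix x g"
      using g(2) depends_strict_prefix[OF assms(4)] depends_strict_prefix[OF x(2)]
      by (meson prefix_order.dual_order.trans strict_prefix_def)+
    show False
      using assms n x pre g unfolding signalling_def signalling_path_def by blast
  qed
  then show ?thesis unfolding sees_subset_iff by blast
qed

text \<open>For incomparable \<open>u\<close> and \<open>w\<close>, a universal quantifier above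
  \<open>p\<close> that both miss would make the tree coordinated. So if \<open>u\<close> misses
  \<open>t1\<close> and \<open>w\<close> misses \<open>t2\<close>, then \<open>w\<close> sees
  \<open>t1\<close> and \<open>u\<close> sees \<open>t2\<close>; with both above the disjunction
  this is a GH2 pattern.\<close>

lemma comparable_across:
  assumes "\<not> GH2 T" "\<not> coordinated T" "conn_at T p Or" "exists_at T u" "exists_at T w"
    "prefix (p @ [i]) u" "prefix (p @ [j]) w" "i \<noteq> j"
  shows "comparable {} (sees T u) (sees T w) \<or> univs_above T p \<subseteq> sees T u \<or> univs_above T p \<subseteq> sees T w"
proof (rule ccontr)
  assume "\<not> ?thesis"
  then obtain x z t1 t2 where x: "forall_at T x" "depends T u x" "\<not> depends T w x"
    and z: "forall_at T z" "depends T w z" "\<not> depends T u z"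
    and t1: "forall_at T t1" "strict_prefix t1 p" "\<not> depends T u t1"
    and t2: "forall_at T t2" "strict_prefix t2 p" "\<not> depends T w t2"
    unfolding comparable_def Un_empty_right sees_subset_iff univs_above_subset_iff by blast
  have inc: "\<not> depends T u w" "\<not> depends T w u"
    using assms(6-8) depends_strict_prefix[of T u w] depends_strict_prefix[of T w u]
    by (auto simp: prefix_def strict_prefix_def)
  have pu: "strict_prefix p u" "strict_prefix p w"
    using assms(6,7) by (auto simp: prefix_def strict_prefix_def)
  have coord: "depends T w t \<or> depends T u t" if "forall_at T t" "strict_prefix t p" for t
    using assms(2-5) that x z inc pu unfolding coordinated_def by blast
  then have "depends T w t1" "depends T u t2" using t1 t2 by blast+
  then have "gen_henkin_pattern T t2 t1 u w p"
    using t1 t2 inc assms(3-8) pu unfolding gen_henkin_pattern_def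
    by (meson prefix_order.less_trans)
  then show False using assms(1) t1(2) unfolding GH2_def by blast
qed

lemma tame_dtree_of:
  assumes "no_conjunctions T" "\<not> GH2 T" "\<not> coordinated T" "\<not> henkin T" "\<not> signalling T"
  shows "subtree_at T p = Some t \<Longrightarrow> tame {} (univs_above T p) (dtree_of T t p)"
proof (induction t arbitrary: p)
  case (Quant Q v V t)
  then have sub: "subtree_at T (p @ [0]) = Some t" by (simp add: subtree_at_append)
  have q: "quant_at T p Q v V" using Quant.prems by (simp add: quant_at_def)
  show ?case
  proof (cases Q)
    case Forall
    then show ?thesis using Quant.IH[OF sub] univs_above_forall q by simp
  next
    case Exists
    then have "\<not> forall_at T p" using q quant_at_fun unfolding forall_at_def by blast
    moreover have "exists_at T p" using q Exists by (auto simp: exists_at_def)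
    then have "comparable {} (sees T p) D" if "D \<in> deps (dtree_of T t (p @ [0]))" for D
      using deps_dtree_of[OF sub that] comparable_on_path[OF assms(4,5)]
      by (metis prefix_snocD)
    ultimately show ?thesis using Quant.IH[OF sub] univs_above_other[of T p 0] Exists by simp
  qed
next
  case (Conn c l r)
  then have sub: "subtree_at T (p @ [0]) = Some l" "subtree_at T (p @ [1]) = Some r"
    by (simp_all add: subtree_at_append)
  have ab: "univs_above T (p @ [i]) = univs_above T p" for i
    by (rule univs_above_other) (use Conn.prems in \<open>auto simp: forall_at_def quant_at_def\<close>)
  have "c = Or" using subtree_at_no_conjunctions[OF Conn.prems assms(1)] by (cases c) auto
  then have c: "conn_at T p Or" using Conn.prems by (simp add: conn_at_def)
  have "comparable {} D D' \<or> univs_above T p \<subseteq> D \<or> univs_above T p \<subseteq> D'"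
    if "D \<in> deps (dtree_of T l (p @ [0]))" "D' \<in> deps (dtree_of T r (p @ [1]))" for D D'
    using deps_dtree_of[OF sub(1) that(1)] deps_dtree_of[OF sub(2) that(2)]
      comparable_across[OF assms(2,3) c, of _ _ 0 1] by auto
  then show ?case using Conn.IH(1)[OF sub(1)] Conn.IH(2)[OF sub(2)] ab by auto
qed simp

section \<open>Team semantics as a game\<close>

text \<open>Strategies are indexed by addresses, since a variable may be bound on several branches.
  Handing over only the part of the assignment outside the slash set builds uniformity into the type
  of argument.\<close>

primrec strat_win :: "'a struc \<Rightarrow> (nat list \<Rightarrow> 'a assignment \<Rightarrow> 'a) \<Rightarrow> (nat list \<Rightarrow> if_formula)
    \<Rightarrow> pi_tree \<Rightarrow> nat list \<Rightarrow> 'a assignment \<Rightarrow> bool" where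
  "strat_win M F e (Leaf u) p s = fo_sat M s (to_fo (e p))"
| "strat_win M F e (Quant Q v V t) p s = (case Q of
      Forall \<Rightarrow> \<forall>a\<in>carrier M. strat_win M F e t (p @ [0]) (s(v \<mapsto> a))
    | Exists \<Rightarrow> strat_win M F e t (p @ [0]) (s(v \<mapsto> F p (s |` (- fset V)))))"
| "strat_win M F e (Conn c l r) p s =
     (strat_win M F e l (p @ [0]) s \<or> strat_win M F e r (p @ [1]) s)"

lemma strat_win_cong:
  "(\<And>q. prefix p q \<Longrightarrow> F q = F' q) \<Longrightarrow> strat_win M F e t p s = strat_win M F' e t p s"
proof (induction t arbitrary: p s)
  case (Quant Q v V t)
  have "strat_win M F e t (p @ [0]) s' = strat_win M F' e t (p @ [0]) s'" for s'
    by (rule Quant.IH) (use Quant.prems append_prefixD in blast)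
  moreover have "F p = F' p" using Quant.prems by simp
  ultimately show ?case by (cases Q) (simp_all del: fun_upd_apply)
next
  case (Conn c l r)
  have "strat_win M F e l (p @ [0]) s = strat_win M F' e l (p @ [0]) s"
    by (rule Conn.IH) (use Conn.prems append_prefixD in blast)
  moreover have "strat_win M F e r (p @ [1]) s = strat_win M F' e r (p @ [1]) s"
    by (rule Conn.IH) (use Conn.prems append_prefixD in blast)
  ultimately show ?case by simp
qed simp

text \<open>The choices made for different nodes live at different addresses, so the strategies for
  the subtrees merge into one. It is then played from each assignment of the team
  separately.\<close>

lemma team_sat_completion:
  assumes "carrier M \<noteq> {}" "no_conjunctions t"
    "\<And>g. is_path t g \<Longrightarrow> quantifier_free (e (p @ g))"
  shows "team_sat M (completion t (\<lambda>q. e (p @ q))) X \<longleftrightarrow>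
    (\<exists>F. (\<forall>q s. F q s \<in> carrier M) \<and> (\<forall>s\<in>X. strat_win M F e t p s))"
  using assms(2,3)
proof (induction t arbitrary: p X)
  case (Leaf u)
  have "quantifier_free (e p)" using Leaf.prems(2)[of "[]"] by (simp add: is_path_def)
  moreover obtain c where "c \<in> carrier M" using assms(1) by blast
  ultimately show ?case
    by (auto simp: team_sat_first_order first_order_if_quantifier_free intro: exI[of _ "\<lambda>_ _. c"])
next
  case (Quant Q v V t)
  have qf: "quantifier_free (e ((p @ [0]) @ g))" if "is_path t g" for g
    using that Quant.prems(2)[of "0 # g"] by (simp add: is_path_def)
  have ih: "team_sat M (completion t (\<lambda>q. e (p @ 0 # q))) Y \<longleftrightarrow>
    (\<exists>F. (\<forall>q s. F q s \<in> carrier M) \<and> (\<forall>s\<in>Y. strat_win M F e t (p @ [0]) s))" for Y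
    using Quant.IH[of "p @ [0]" Y] qf Quant.prems(1) by simp
  show ?case
  proof (cases Q)
    case Forall
    have "team_sat M (completion (Quant Q v V t) (\<lambda>q. e (p @ q))) X \<longleftrightarrow>
      (\<exists>F. (\<forall>q s. F q s \<in> carrier M) \<and>
        (\<forall>s'\<in>{s(v \<mapsto> a) | s a. s \<in> X \<and> a \<in> carrier M}. strat_win M F e t (p @ [0]) s'))"
      using ih Forall by simp
    also have "\<dots> \<longleftrightarrow> (\<exists>F. (\<forall>q s. F q s \<in> carrier M) \<and> (\<forall>s\<in>X. strat_win M F e (Quant Q v V t) p s))"
      unfolding Forall strat_win.simps quantifier.case by blast
    finally show ?thesis .
  next
    case Exists
    show ?thesis
    proof
      assume "team_sat M (completion (Quant Q v V t) (\<lambda>q. e (p @ q))) X"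
      then obtain F0 where F0: "\<forall>s\<in>X. F0 s \<in> carrier M" "uniform (fset V) X F0"
        "team_sat M (completion t (\<lambda>q. e (p @ 0 # q))) {s(v \<mapsto> F0 s) | s. s \<in> X}"
        using Exists by auto
      obtain F1 where F1: "\<forall>q s. F1 q s \<in> carrier M"
        "\<forall>s\<in>X. strat_win M F1 e t (p @ [0]) (s(v \<mapsto> F0 s))"
        using F0(3) unfolding ih by blast
      obtain c where c: "c \<in> carrier M" using assms(1) by blast
      \<comment> \<open>Uniformity makes \<open>F0\<close> a function of the restricted assignment:
        any member of the team with that restriction may represent it. On restrictions that do not
        occur the value \<open>c\<close> is arbitrary.\<close>
      define f where "f r = (if \<exists>s\<in>X. r = s |` (- fset V)
        then F0 (SOME s. s \<in> X \<and> r = s |` (- fset V)) else c)" for r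
      have f: "f (s |` (- fset V)) = F0 s" if s: "s \<in> X" for s :: "nat \<rightharpoonup> 'a"
      proof -
        let ?P = "\<lambda>s'. s' \<in> X \<and> s |` (- fset V) = s' |` (- fset V)"
        have "\<exists>s'. ?P s'" using s by blast
        then have P: "?P (SOME s'. ?P s')" by (rule someI_ex)
        define s0 where "s0 = (SOME s'. ?P s')"
        have s0: "s0 \<in> X" "s |` (- fset V) = s0 |` (- fset V)" using P unfolding s0_def by simp_all
        have eq: "\<forall>x. x \<notin> fset V \<longrightarrow> s0 x = s x"
        proof (intro allI impI)
          fix x assume "x \<notin> fset V"
          then show "s0 x = s x"
            using fun_cong[OF s0(2), of x] by (simp add: restrict_map_def)
        qed
        have "F0 s0 = F0 s"
          using F0(2)[unfolded uniform_def, rule_format, OF s0(1) s] eq by blast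
        moreover have "\<exists>s'\<in>X. s |` (- fset V) = s' |` (- fset V)" using s by blast
        ultimately show ?thesis unfolding f_def s0_def by simp
      qed
      have fc: "f r \<in> carrier M" for r
      proof (cases "\<exists>s\<in>X. r = s |` (- fset V)")
        case True
        then show ?thesis using f F0(1) by auto
      qed (simp add: f_def c)
      \<comment> \<open>The subtree consults only addresses that properly extend \<open>p\<close>,
        so the change at \<open>p\<close> does not reach it.\<close>
      define F where "F = F1(p := f)"
      have "strat_win M F e t (p @ [0]) s = strat_win M F1 e t (p @ [0]) s" for s
        by (rule strat_win_cong) (auto simp: F_def)
      moreover have "F p = f" by (simp add: F_def)
      ultimately have "\<forall>s\<in>X. strat_win M F e (Quant Q v V t) p s"
        using F1(2) f Exists by (simp del: fun_upd_apply)
      moreover have "\<forall>q s. F q s \<in> carrier M" using F1(1) fc by (simp add: F_def)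
      ultimately show "\<exists>F. (\<forall>q s. F q s \<in> carrier M) \<and> (\<forall>s\<in>X. strat_win M F e (Quant Q v V t) p s)"
        by blast
    next
      assume "\<exists>F. (\<forall>q s. F q s \<in> carrier M) \<and> (\<forall>s\<in>X. strat_win M F e (Quant Q v V t) p s)"
      then obtain F where F: "\<forall>q s. F q s \<in> carrier M"
        "\<forall>s\<in>X. strat_win M F e t (p @ [0]) (s(v \<mapsto> F p (s |` (- fset V))))"
        using Exists by auto
      let ?F0 = "\<lambda>s. F p (s |` (- fset V))"
      have "uniform (fset V) X ?F0"
        unfolding uniform_def
      proof (intro ballI impI)
        fix s s' :: "nat \<rightharpoonup> 'a" assume "\<forall>x. x \<notin> fset V \<longrightarrow> s x = s' x"
        then have "s |` (- fset V) = s' |` (- fset V)" by (auto simp: restrict_map_def)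
        then show "?F0 s = ?F0 s'" by simp
      qed
      moreover have "team_sat M (completion t (\<lambda>q. e (p @ 0 # q))) {s(v \<mapsto> ?F0 s) | s. s \<in> X}"
        unfolding ih using F by (intro exI[of _ F]) (auto simp del: fun_upd_apply)
      ultimately show "team_sat M (completion (Quant Q v V t) (\<lambda>q. e (p @ q))) X"
        unfolding Exists completion.simps team_sat.simps quantifier.case append_Cons
        using F(1) by (intro exI[of _ ?F0]) simp
    qed
  qed
next
  case (Conn c l r)
  have qf: "quantifier_free (e ((p @ [0]) @ g))" if "is_path l g" for g
    using that Conn.prems(2)[of "0 # g"] by (simp add: is_path_def)
  have qf': "quantifier_free (e ((p @ [1]) @ g))" if "is_path r g" for g
    using that Conn.prems(2)[of "1 # g"] by (simp add: is_path_def)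
  have ihl: "team_sat M (completion l (\<lambda>q. e (p @ 0 # q))) Y \<longleftrightarrow>
    (\<exists>F. (\<forall>q s. F q s \<in> carrier M) \<and> (\<forall>s\<in>Y. strat_win M F e l (p @ [0]) s))" for Y
    using Conn.IH(1)[of "p @ [0]" Y] qf Conn.prems(1) by simp
  have ihr: "team_sat M (completion r (\<lambda>q. e (p @ 1 # q))) Y \<longleftrightarrow>
    (\<exists>F. (\<forall>q s. F q s \<in> carrier M) \<and> (\<forall>s\<in>Y. strat_win M F e r (p @ [1]) s))" for Y
    using Conn.IH(2)[of "p @ [1]" Y] qf' Conn.prems(1) by simp
  have c: "c = Or" using Conn.prems(1) by (cases c) auto
  show ?case
  proof
    assume "team_sat M (completion (Conn c l r) (\<lambda>q. e (p @ q))) X"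
    then obtain Y Z where X: "X = Y \<union> Z" and YZ: "team_sat M (completion l (\<lambda>q. e (p @ 0 # q))) Y"
      "team_sat M (completion r (\<lambda>q. e (p @ 1 # q))) Z"
      unfolding c completion.simps team_sat.simps connective.case by blast
    obtain Fl where Fl: "\<forall>q s. Fl q s \<in> carrier M" "\<forall>s\<in>Y. strat_win M Fl e l (p @ [0]) s"
      using YZ(1) unfolding ihl by blast
    obtain Fr where Fr: "\<forall>q s. Fr q s \<in> carrier M" "\<forall>s\<in>Z. strat_win M Fr e r (p @ [1]) s"
      using YZ(2) unfolding ihr by blast
    \<comment> \<open>The address tells on which side of the disjunction a move is made.\<close>
    define F where "F q = (if prefix (p @ [0]) q then Fl q else Fr q)" for q
    have "strat_win M F e l (p @ [0]) s = strat_win M Fl e l (p @ [0]) s" for s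
      by (rule strat_win_cong) (simp add: F_def)
    moreover have "strat_win M F e r (p @ [1]) s = strat_win M Fr e r (p @ [1]) s" for s
      by (rule strat_win_cong) (auto simp: F_def prefix_def)
    ultimately have "\<forall>s\<in>X. strat_win M F e (Conn c l r) p s" using X Fl Fr by auto
    moreover have "\<forall>q s. F q s \<in> carrier M" using Fl Fr by (simp add: F_def)
    ultimately show "\<exists>F. (\<forall>q s. F q s \<in> carrier M) \<and> (\<forall>s\<in>X. strat_win M F e (Conn c l r) p s)"
      by blast
  next
    assume "\<exists>F. (\<forall>q s. F q s \<in> carrier M) \<and> (\<forall>s\<in>X. strat_win M F e (Conn c l r) p s)"
    then obtain F where F: "\<forall>q s. F q s \<in> carrier M" "\<forall>s\<in>X. strat_win M F e (Conn c l r) p s"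
      by blast
    \<comment> \<open>The team is split by the side on which the strategy wins; the parts may
      overlap.\<close>
    have "X = {s\<in>X. strat_win M F e l (p @ [0]) s} \<union> {s\<in>X. strat_win M F e r (p @ [1]) s}"
      using F(2) by auto
    then show "team_sat M (completion (Conn c l r) (\<lambda>q. e (p @ q))) X"
      unfolding c completion.simps team_sat.simps connective.case ihl ihr using F(1) by blast
  qed
qed

section \<open>Binders of variables, and the passage from states to assignments\<close>

definition binding_addr :: "pi_tree \<Rightarrow> nat list \<Rightarrow> nat \<Rightarrow> nat list option" where
  "binding_addr T p v = (if \<exists>q Q V. strict_prefix q p \<and> quant_at T q Q v V
     then Some (SOME q. strict_prefix q p \<and> (\<exists>Q V. quant_at T q Q v V)) else None)"

lemma binder_SomeD: "binding_addr T p v = Some q \<Longrightarrow> strict_prefix q p \<and> (\<exists>Q V. quant_at T q Q v V)"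
proof -
  assume a: "binding_addr T p v = Some q"
  then have "\<exists>q. strict_prefix q p \<and> (\<exists>Q V. quant_at T q Q v V)"
    by (auto simp: binding_addr_def split: if_splits)
  from someI_ex[OF this] show ?thesis using a by (auto simp: binding_addr_def split: if_splits)
qed

text \<open>Two binders of \<open>v\<close> above \<open>p\<close> are comparable, both being
  prefixes of \<open>p\<close>, and nested ones would requantify \<open>v\<close>.\<close>

lemma binder_eq:
  assumes "no_requantification T" "strict_prefix q p" "quant_at T q Q v V"
  shows "binding_addr T p v = Some q"
proof -
  have "binding_addr T p v \<noteq> None" using assms unfolding binding_addr_def by auto
  then obtain q' where q': "binding_addr T p v = Some q'" by blast
  then obtain Q' V' where s: "strict_prefix q' p" "quant_at T q' Q' v V'" using binder_SomeD by blast
  have "\<not> strict_prefix q q'" "\<not> strict_prefix q' q"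
    using no_requantification_unique[OF assms(1)] assms(3) s by blast+
  moreover have "prefix q q' \<or> prefix q' q"
    using s(1) assms(2) prefix_same_cases by (meson strict_prefix_def)
  ultimately show ?thesis using q' by (auto simp: strict_prefix_def)
qed

lemma binder_None: "binding_addr T p v = None \<longleftrightarrow> \<not> (\<exists>q Q V. strict_prefix q p \<and> quant_at T q Q v V)"
  by (auto simp: binding_addr_def)

lemma binder_Nil: "binding_addr T [] v = None"
  by (simp add: binder_None)

lemma binder_quant:
  assumes "no_requantification T" "quant_at T p Q v V"
  shows "binding_addr T (p @ [i]) = (binding_addr T p)(v \<mapsto> p)"
proof
  fix x
  show "binding_addr T (p @ [i]) x = ((binding_addr T p)(v \<mapsto> p)) x"
  proof (cases "x = v")
    case True
    then show ?thesis using binder_eq[OF assms(1) _ assms(2), of "p @ [i]"] by (simp add: strict_prefix_snoc)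
  next
    case False
    show ?thesis
    proof (cases "binding_addr T p x")
      case None
      then have "\<not> quant_at T q Q' x V'" if "prefix q p" for q Q' V'
        using that False quant_at_fun[OF assms(2)] unfolding binder_None
        by (metis strict_prefix_def)
      then have "binding_addr T (p @ [i]) x = None" unfolding binder_None strict_prefix_snoc by blast
      then show ?thesis using None False by simp
    next
      case (Some q)
      then obtain Q' V' where "strict_prefix q p" "quant_at T q Q' x V'" using binder_SomeD by blast
      then show ?thesis
        using binder_eq[OF assms(1), of q "p @ [i]"] False Some by (simp add: strict_prefix_snoc)
    qed
  qed
qed

lemma binder_conn:
  assumes "no_requantification T" "subtree_at T p = Some (Conn c l r)"
  shows "binding_addr T (p @ [i]) = binding_addr T p"
proof
  fix x
  show "binding_addr T (p @ [i]) x = binding_addr T p x"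
  proof (cases "binding_addr T p x")
    case None
    then have "\<not> quant_at T q Q' x V'" if "prefix q p" for q Q' V'
      using that assms(2) unfolding binder_None
      by (metis quant_at_def option.inject strict_prefix_def tree.distinct(5))
    then have "binding_addr T (p @ [i]) x = None" unfolding binder_None strict_prefix_snoc by blast
    then show ?thesis using None by simp
  next
    case (Some q)
    then obtain Q' V' where "strict_prefix q p" "quant_at T q Q' x V'" using binder_SomeD by blast
    then show ?thesis
      using binder_eq[OF assms(1), of q "p @ [i]"] Some by (simp add: strict_prefix_snoc)
  qed
qed

text \<open>States give values to addresses, assignments to variables; the value of a variable is
  found at its binder above \<open>p\<close>, and a variable without one is undefined.\<close>

definition asg_of :: "pi_tree \<Rightarrow> nat list \<Rightarrow> (nat \<Rightarrow> 'a) \<Rightarrow> 'a assignment" where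
  "asg_of T p \<tau> = (\<lambda>v. map_option (\<lambda>q. \<tau> (to_nat q)) (binding_addr T p v))"

lemma asg_of_quant:
  assumes "no_requantification T" "quant_at T p Q v V"
  shows "asg_of T (p @ [i]) (\<tau>(to_nat p := a)) = (asg_of T p \<tau>)(v \<mapsto> a)"
proof
  fix x
  show "asg_of T (p @ [i]) (\<tau>(to_nat p := a)) x = ((asg_of T p \<tau>)(v \<mapsto> a)) x"
  proof (cases "binding_addr T p x")
    case None
    then show ?thesis by (simp add: asg_of_def binder_quant[OF assms])
  next
    case (Some q)
    then have "q \<noteq> p" using binder_SomeD by fastforce
    then show ?thesis using Some by (simp add: asg_of_def binder_quant[OF assms])
  qed
qed

lemma asg_of_conn:
  assumes "no_requantification T" "subtree_at T p = Some (Conn c l r)"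
  shows "asg_of T (p @ [i]) \<tau> = asg_of T p \<tau>"
  by (simp add: asg_of_def binder_conn[OF assms])

lemma depends_iff:
  assumes "quant_at T p Q y Y" "quant_at T q Q' x X" "strict_prefix q p"
  shows "depends T p q \<longleftrightarrow> x |\<notin>| Y"
  using assms quant_at_fun unfolding depends_def by blast

lemma forall_or_exists: "quant_at T q Q x X \<Longrightarrow> forall_at T q \<or> exists_at T q"
  unfolding forall_at_def exists_at_def by (cases Q) auto

lemma not_forall_exists: "exists_at T p \<Longrightarrow> \<not> forall_at T p"
  unfolding forall_at_def exists_at_def using quant_at_fun by blast

section \<open>Trading strategies on assignments for Skolem functions of universal values\<close>

definition leaf_pred :: "'a struc \<Rightarrow> pi_tree \<Rightarrow> (nat list \<Rightarrow> if_formula) \<Rightarrow> nat list \<Rightarrow> (nat \<Rightarrow> 'a) \<Rightarrow> bool" where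
  "leaf_pred M T e g \<tau> = fo_sat M (asg_of T g \<tau>) (to_fo (e g))"

text \<open>Recomputes the existential values visible at \<open>p\<close> from universal ones. Without signalling,
  everything a visible existential quantifier depends on is itself visible at \<open>p\<close>.\<close>

function reduced_strat :: "pi_tree \<Rightarrow> (nat list \<Rightarrow> 'a assignment \<Rightarrow> 'a) \<Rightarrow> nat list \<Rightarrow> (nat \<Rightarrow> 'a) \<Rightarrow> 'a" where
  "reduced_strat T F p \<rho> = F p (\<lambda>x. case binding_addr T p x of None \<Rightarrow> None
     | Some q \<Rightarrow> (if depends T p q
         then Some (if forall_at T q then \<rho> (to_nat q) else reduced_strat T F q (restr \<rho> (sees T q)))
         else None))"
  by pat_completeness auto
termination
  by (relation "measure (\<lambda>(T, F, p, \<rho>). length p)")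
    (auto dest!: depends_strict_prefix prefix_length_less)

declare reduced_strat.simps [simp del]

text \<open>The second premise is the invariant that the existential values in the state are those
  that \<open>reduced_strat\<close> recomputes. It makes the argument rebuilt at \<open>p\<close>
  equal to the restricted assignment shown to \<open>F\<close> in the original game, so both
  strategies make the same moves.\<close>

lemma win_if_strat_win:
  assumes "no_requantification T" "no_conjunctions T" "\<not> signalling T"
  shows "subtree_at T p = Some t \<Longrightarrow>
    (\<forall>q. strict_prefix q p \<longrightarrow> exists_at T q \<longrightarrow> \<tau> (to_nat q) = reduced_strat T F q (restr \<tau> (sees T q))) \<Longrightarrow>
    strat_win M F e t p (asg_of T p \<tau>) \<Longrightarrow>
    win (carrier M) (leaf_pred M T e) (\<lambda>n. reduced_strat T F (from_nat n)) (dtree_of T t p) \<tau>"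
proof (induction t arbitrary: p \<tau>)
  case (Leaf u)
  then show ?case by (simp add: leaf_pred_def)
next
  case (Quant Q v V t)
  then have sub: "subtree_at T (p @ [0]) = Some t" by (simp add: subtree_at_append)
  have q: "quant_at T p Q v V" using Quant.prems(1) by (simp add: quant_at_def)
  \<comment> \<open>\<open>sees T q\<close> contains only proper prefixes of \<open>q\<close>, so a
    change at \<open>p\<close> is invisible from every \<open>q\<close> weakly above it.\<close>
  have restr_upd': "restr (\<tau>(to_nat p := a)) (sees T q) = restr \<tau> (sees T q)" if "prefix q p" for q a
    using that depends_strict_prefix[of T q p] by (intro restr_upd) auto
  have upd: "\<forall>q. strict_prefix q (p @ [0]) \<longrightarrow> exists_at T q \<longrightarrow>
      (\<tau>(to_nat p := a)) (to_nat q) = reduced_strat T F q (restr (\<tau>(to_nat p := a)) (sees T q))"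
    if "exists_at T p \<Longrightarrow> a = reduced_strat T F p (restr \<tau> (sees T p))" for a
  proof (intro allI impI)
    fix q assume "strict_prefix q (p @ [0])" and ex: "exists_at T q"
    then have "prefix q p" by (simp add: strict_prefix_snoc)
    then show "(\<tau>(to_nat p := a)) (to_nat q) = reduced_strat T F q (restr (\<tau>(to_nat p := a)) (sees T q))"
      unfolding restr_upd'[OF \<open>prefix q p\<close>]
      using that ex Quant.prems(2) by (cases "q = p") (auto simp: strict_prefix_def)
  qed
  show ?case
  proof (cases Q)
    case Forall
    then have "\<not> exists_at T p" using q not_forall_exists unfolding forall_at_def by blast
    then have "win (carrier M) (leaf_pred M T e) (\<lambda>n. reduced_strat T F (from_nat n))
        (dtree_of T t (p @ [0])) (\<tau>(to_nat p := a))" if "a \<in> carrier M" for a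
      by (intro Quant.IH[OF sub upd])
        (use Quant.prems(3) Forall that in \<open>auto simp: asg_of_quant[OF assms(1) q] simp del: fun_upd_apply\<close>)
    then show ?thesis using Forall by simp
  next
    case Exists
    then have ex: "exists_at T p" using q by (auto simp: exists_at_def)
    let ?\<rho> = "restr \<tau> (sees T p)"
    have "asg_of T p \<tau> |` (- fset V) = (\<lambda>x. case binding_addr T p x of None \<Rightarrow> None
     | Some q \<Rightarrow> (if depends T p q
         then Some (if forall_at T q then ?\<rho> (to_nat q) else reduced_strat T F q (restr ?\<rho> (sees T q)))
         else None))" (is "_ = ?r")
    proof
      fix x
      show "(asg_of T p \<tau> |` (- fset V)) x = ?r x"
      proof (cases "binding_addr T p x")
        case None
        then show ?thesis by (simp add: asg_of_def restrict_map_def)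
      next
        case (Some y)
        then obtain Q' X where y: "strict_prefix y p" "quant_at T y Q' x X" using binder_SomeD by blast
        have dep: "depends T p y \<longleftrightarrow> x |\<notin>| V" using depends_iff[OF q y(2,1)] .
        show ?thesis
        proof (cases "depends T p y")
          case False
          then show ?thesis using dep Some by (simp add: restrict_map_def)
        next
          case True
          show ?thesis
          proof (cases "forall_at T y")
            case fa: True
            then have "?\<rho> (to_nat y) = \<tau> (to_nat y)" using True by (simp add: restr_def)
            then show ?thesis using True fa dep Some by (simp add: restrict_map_def asg_of_def)
          next
            case False
            then have exy: "exists_at T y" using forall_or_exists y(2) by blast
            \<comment> \<open>Absence of signalling: whatever \<open>y\<close> sees is also seen by
              \<open>p\<close>, so restricting twice loses nothing that \<open>y\<close>
              needs.\<close>
            have "restr ?\<rho> (sees T y) = restr \<tau> (sees T y)"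
              by (rule restr_restr[OF sees_mono_depends[OF assms(3) exy ex True]])
            then have "reduced_strat T F y (restr ?\<rho> (sees T y)) = \<tau> (to_nat y)"
              using Quant.prems(2) y(1) exy by simp
            then show ?thesis using True False dep Some by (simp add: restrict_map_def asg_of_def)
          qed
        qed
      qed
    qed
    then have val: "reduced_strat T F p ?\<rho> = F p (asg_of T p \<tau> |` (- fset V))"
      by (subst reduced_strat.simps) simp
    have "win (carrier M) (leaf_pred M T e) (\<lambda>n. reduced_strat T F (from_nat n))
        (dtree_of T t (p @ [0])) (\<tau>(to_nat p := reduced_strat T F p ?\<rho>))"
      by (intro Quant.IH[OF sub upd])
        (use Quant.prems(3) Exists in \<open>auto simp: asg_of_quant[OF assms(1) q] val simp del: fun_upd_apply\<close>)
    then show ?thesis using Exists by simp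
  qed
next
  case (Conn c l r)
  then have sub: "subtree_at T (p @ [0]) = Some l" "subtree_at T (p @ [1]) = Some r"
    by (simp_all add: subtree_at_append)
  have cons: "\<forall>q. strict_prefix q (p @ [i]) \<longrightarrow> exists_at T q \<longrightarrow>
      \<tau> (to_nat q) = reduced_strat T F q (restr \<tau> (sees T q))" for i
    using Conn.prems(1,2) unfolding strict_prefix_snoc
    by (metis exists_at_def quant_at_def option.inject strict_prefix_def tree.distinct(5))
  have "strat_win M F e l (p @ [0]) (asg_of T (p @ [0]) \<tau>) \<or> strat_win M F e r (p @ [1]) (asg_of T (p @ [1]) \<tau>)"
    using Conn.prems(3) unfolding asg_of_conn[OF assms(1) Conn.prems(1)] by simp
  then show ?case using Conn.IH(1)[OF sub(1) cons] Conn.IH(2)[OF sub(2) cons] by auto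
qed

definition var_at :: "pi_tree \<Rightarrow> nat list \<Rightarrow> nat" where
  "var_at T q = (THE v. \<exists>Q V. quant_at T q Q v V)"

lemma var_at_eq: "quant_at T q Q v V \<Longrightarrow> var_at T q = v"
  unfolding var_at_def using quant_at_fun by blast

definition lifted_strat :: "pi_tree \<Rightarrow> (nat \<Rightarrow> (nat \<Rightarrow> 'a) \<Rightarrow> 'a) \<Rightarrow> nat list \<Rightarrow> 'a assignment \<Rightarrow> 'a" where
  "lifted_strat T G p s = G (to_nat p) (restr (\<lambda>n. the (s (var_at T (from_nat n)))) (sees T p))"

text \<open>A universal quantifier in \<open>sees T p\<close> has its variable outside the slash set
  at \<open>p\<close>, so the restricted assignment still shows every value that the Skolem function
  reads.\<close>

lemma strat_win_if_win:
  assumes "no_requantification T"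
  shows "subtree_at T p = Some t \<Longrightarrow> win (carrier M) (leaf_pred M T e) G (dtree_of T t p) \<tau> \<Longrightarrow>
    strat_win M (lifted_strat T G) e t p (asg_of T p \<tau>)"
proof (induction t arbitrary: p \<tau>)
  case (Leaf u)
  then show ?case by (simp add: leaf_pred_def)
next
  case (Quant Q v V t)
  then have sub: "subtree_at T (p @ [0]) = Some t" by (simp add: subtree_at_append)
  have q: "quant_at T p Q v V" using Quant.prems(1) by (simp add: quant_at_def)
  show ?case
  proof (cases Q)
    case Forall
    have "strat_win M (lifted_strat T G) e t (p @ [0]) ((asg_of T p \<tau>)(v \<mapsto> a))" if "a \<in> carrier M" for a
      using Quant.IH[OF sub, of "\<tau>(to_nat p := a)"] Quant.prems(2) that Forall
      by (simp add: asg_of_quant[OF assms q] del: fun_upd_apply)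
    then show ?thesis using Forall by simp
  next
    case Exists
    have "restr (\<lambda>n. the ((asg_of T p \<tau> |` (- fset V)) (var_at T (from_nat n)))) (sees T p) =
        restr \<tau> (sees T p)"
      unfolding restr_eq_iff
    proof
      fix n assume "n \<in> sees T p"
      then obtain y where y: "n = to_nat y" "forall_at T y" "depends T p y" by (auto simp: sees_def)
      obtain x X where x: "quant_at T y Forall x X" using y(2) by (auto simp: forall_at_def)
      have sp: "strict_prefix y p" using depends_strict_prefix[OF y(3)] .
      have "x |\<notin>| V" using depends_iff[OF q x sp] y(3) by simp
      moreover have "binding_addr T p x = Some y" by (rule binder_eq[OF assms sp x])
      ultimately show "the ((asg_of T p \<tau> |` (- fset V)) (var_at T (from_nat n))) = \<tau> n"
        by (simp add: y(1) var_at_eq[OF x] restrict_map_def asg_of_def)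
    qed
    then have "lifted_strat T G p (asg_of T p \<tau> |` (- fset V)) = G (to_nat p) (restr \<tau> (sees T p))"
      by (simp add: lifted_strat_def)
    then show ?thesis
      using Quant.IH[OF sub, of "\<tau>(to_nat p := G (to_nat p) (restr \<tau> (sees T p)))"] Quant.prems(2) Exists
      by (simp add: asg_of_quant[OF assms q] del: fun_upd_apply)
  qed
next
  case (Conn c l r)
  then have sub: "subtree_at T (p @ [0]) = Some l" "subtree_at T (p @ [1]) = Some r"
    by (simp_all add: subtree_at_append)
  show ?case
    using Conn.IH(1)[OF sub(1), of \<tau>] Conn.IH(2)[OF sub(2), of \<tau>] Conn.prems(2)
    unfolding asg_of_conn[OF assms Conn.prems(1)] by auto
qed

lemma models_completion_iff:
  assumes "no_requantification T" "no_conjunctions T" "\<not> signalling T" "weak T e" "carrier M \<noteq> {}"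
  shows "models M (completion T e) \<longleftrightarrow>
    skolem_sat (carrier M) (leaf_pred M T e) (dtree_of T T []) \<tau>"
proof -
  \<comment> \<open>No variable has a binder at the root, so every state stands for the empty
    assignment; this is why \<open>\<tau>\<close> is arbitrary.\<close>
  have asg: "asg_of T [] \<tau> = Map.empty" by (simp add: asg_of_def binder_Nil)
  have "models M (completion T e) \<longleftrightarrow>
    (\<exists>F. (\<forall>q s. F q s \<in> carrier M) \<and> strat_win M F e T [] Map.empty)"
    using team_sat_completion[OF assms(5,2), of e "[]" "{Map.empty}"] assms(4)
    by (simp add: models_def weak_def)
  also have "\<dots> \<longleftrightarrow> skolem_sat (carrier M) (leaf_pred M T e) (dtree_of T T []) \<tau>"
  proof
    assume "\<exists>F. (\<forall>q s. F q s \<in> carrier M) \<and> strat_win M F e T [] Map.empty"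
    then obtain F where F: "\<forall>q s. F q s \<in> carrier M" "strat_win M F e T [] Map.empty" by blast
    have "win (carrier M) (leaf_pred M T e) (\<lambda>n. reduced_strat T F (from_nat n)) (dtree_of T T []) \<tau>"
      by (rule win_if_strat_win[OF assms(1-3)]) (use F(2) asg in auto)
    moreover have "reduced_strat T F q \<rho> \<in> carrier M" for q \<rho>
      using F(1) by (subst reduced_strat.simps) simp
    ultimately show "skolem_sat (carrier M) (leaf_pred M T e) (dtree_of T T []) \<tau>"
      unfolding skolem_sat_def by (intro exI[of _ "\<lambda>n. reduced_strat T F (from_nat n)"]) simp
  next
    assume "skolem_sat (carrier M) (leaf_pred M T e) (dtree_of T T []) \<tau>"
    then obtain G where G: "\<forall>u \<tau>. G u \<tau> \<in> carrier M"
      "win (carrier M) (leaf_pred M T e) G (dtree_of T T []) \<tau>" unfolding skolem_sat_def by blast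
    have "strat_win M (lifted_strat T G) e T [] Map.empty"
      using strat_win_if_win[OF assms(1) _ G(2)] asg by simp
    moreover have "\<forall>q s. lifted_strat T G q s \<in> carrier M" using G(1) by (simp add: lifted_strat_def)
    ultimately show "\<exists>F. (\<forall>q s. F q s \<in> carrier M) \<and> strat_win M F e T [] Map.empty" by blast
  qed
  finally show ?thesis .
qed

text \<open>A completed leaf looks up values only at binders above it, so it ignores every address
  that is not on its own path.\<close>

lemma leaf_insens_leaf_pred:
  assumes "no_requantification T"
  shows "subtree_at T p = Some t \<Longrightarrow> (\<forall>q Q v V. strict_prefix q p \<longrightarrow> quant_at T q Q v V \<longrightarrow> to_nat q \<notin> B) \<Longrightarrow>
    leaf_insens B (dtree_of T t p) (leaf_pred M T e)"
proof (induction t arbitrary: p B)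
  case (Leaf u)
  have "asg_of T p \<tau> = asg_of T p \<tau>'" if e: "\<forall>x. x \<notin> B \<longrightarrow> \<tau> x = \<tau>' x" for \<tau> \<tau>' :: "nat \<Rightarrow> 'a"
  proof
    fix v
    have "\<tau> (to_nat q) = \<tau>' (to_nat q)" if "binding_addr T p v = Some q" for q
    proof -
      have "to_nat q \<notin> B" using binder_SomeD[OF that] Leaf.prems(2) by blast
      then show ?thesis using e by blast
    qed
    then show "asg_of T p \<tau> v = asg_of T p \<tau>' v" by (cases "binding_addr T p v") (auto simp: asg_of_def)
  qed
  then have "insens B (leaf_pred M T e p)" unfolding insens_def leaf_pred_def by (metis (no_types, lifting))
  then show ?case by simp
next
  case (Quant Q v V t)
  then have sub: "subtree_at T (p @ [0]) = Some t" by (simp add: subtree_at_append)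
  have "\<forall>q Q v V. strict_prefix q (p @ [0]) \<longrightarrow> quant_at T q Q v V \<longrightarrow> to_nat q \<notin> B - {to_nat p}"
    using Quant.prems(2) unfolding strict_prefix_snoc by (auto simp: strict_prefix_def)
  from Quant.IH[OF sub this] show ?case by (cases Q) auto
next
  case (Conn c l r)
  then have sub: "subtree_at T (p @ [0]) = Some l" "subtree_at T (p @ [1]) = Some r"
    by (simp_all add: subtree_at_append)
  have "\<not> quant_at T p Q v V" for Q v V using Conn.prems(1) by (simp add: quant_at_def)
  then have B: "\<forall>q Q v V. strict_prefix q (p @ [i]) \<longrightarrow> quant_at T q Q v V \<longrightarrow> to_nat q \<notin> B" for i
    using Conn.prems(2) unfolding strict_prefix_snoc by (auto simp: strict_prefix_def)
  show ?case using Conn.IH(1)[OF sub(1) B] Conn.IH(2)[OF sub(2) B] by simp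
qed

section \<open>The first-order tree\<close>

text \<open>Vacuous quantifiers over all addresses in front of the tree make every completion by leaves
  with these variables sentential.\<close>

primrec close :: "nat list \<Rightarrow> 'g tree \<Rightarrow> 'g tree" where
  "close [] t = t"
| "close (n # ns) t = Quant Forall n {||} (close ns t)"

lemma first_order_close: "first_order_tree (close ns t) = first_order_tree t"
  by (induction ns) auto

lemma set_close: "set_tree (close ns t) = set_tree t"
  by (induction ns) auto

lemma path_bound_close: "is_path (map_tree (\<lambda>_. ()) (close ns t)) g \<Longrightarrow>
    set ns \<subseteq> path_bound (map_tree (\<lambda>_. ()) (close ns t)) g"
proof (induction ns arbitrary: g)
  case (Cons n ns)
  then obtain g' where g: "g = 0 # g'" "is_path (map_tree (\<lambda>_. ()) (close ns t)) g'"
    by (cases g) (auto simp: is_path_def split: if_splits)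
  then show ?case using Cons.IH[of g'] by auto
qed simp

lemma fo_eval_close:
  assumes "C \<noteq> {}" "insens B (fo_eval C P t)" "set ns \<subseteq> B"
  shows "fo_eval C P (close ns t) = fo_eval C P t"
  using assms(3)
proof (induction ns)
  case (Cons n ns)
  then have "fo_eval C P t (s(n := a)) = fo_eval C P t s" for s a
    using insens_upd[OF assms(2)] by simp
  then show ?case using Cons assms(1) by (auto simp: fun_eq_iff simp del: fun_upd_apply)
qed simp

lemma fo_eval_cong: "(\<And>g. g \<in> set_tree S \<Longrightarrow> P g = P' g) \<Longrightarrow> fo_eval C P S s = fo_eval C P' S s"
proof (induction S arbitrary: s)
  case (Quant Q v V S)
  then show ?case by (cases Q) simp_all
next
  case (Conn c l r)
  then show ?case by (cases c) simp_all
qed simp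

lemma fo_sat_graft:
  "fo_sat M (\<lambda>x. Some (\<tau> x)) (to_fo (graft f S)) \<longleftrightarrow>
    fo_eval (carrier M) (\<lambda>g \<tau>. fo_sat M (\<lambda>x. Some (\<tau> x)) (to_fo (f g))) S \<tau>"
proof (induction S arbitrary: \<tau>)
  case (Quant Q v V S)
  have "(\<lambda>x. Some (\<tau> x))(v \<mapsto> a) = (\<lambda>x. Some ((\<tau>(v := a)) x))" for a by auto
  then show ?case using Quant by (cases Q) (simp_all del: fun_upd_apply)
next
  case (Conn c l r)
  then show ?case by (cases c) simp_all
qed simp

text \<open>All gaps with the same label receive the same formula, however often grafting has copied
  the label. The value \<open>undefined\<close> arises only at addresses that are not gaps.\<close>

definition leaf_completion :: "('g \<Rightarrow> if_formula) \<Rightarrow> 'g tree \<Rightarrow> nat list \<Rightarrow> if_formula" where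
  "leaf_completion f S g = (case subtree_at S g of Some (Leaf l) \<Rightarrow> f l | _ \<Rightarrow> undefined)"

lemma completion_leaf_completion:
  "completion (map_tree (\<lambda>_. ()) S) (leaf_completion f S) = graft f S"
proof (induction S)
  case (Quant Q v V S)
  have "(\<lambda>g. leaf_completion f (Quant Q v V S) (0 # g)) = leaf_completion f S"
    by (simp add: leaf_completion_def fun_eq_iff)
  then show ?case using Quant by simp
next
  case (Conn c l r)
  have "(\<lambda>g. leaf_completion f (Conn c l r) (0 # g)) = leaf_completion f l"
    "(\<lambda>g. leaf_completion f (Conn c l r) (1 # g)) = leaf_completion f r"
    by (simp_all add: leaf_completion_def fun_eq_iff)
  then show ?case using Conn by simp
qed (simp add: leaf_completion_def)

lemma leaf_completion_path:
  "is_path (map_tree (\<lambda>_. ()) S) g \<Longrightarrow> \<exists>l\<in>set_tree S. leaf_completion f S g = f l"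
proof (induction S arbitrary: g)
  case (Leaf l)
  then show ?case by (cases g) (auto simp: is_path_def leaf_completion_def)
next
  case (Quant Q v V S)
  then obtain g' where "g = 0 # g'" "is_path (map_tree (\<lambda>_. ()) S) g'"
    by (cases g) (auto simp: is_path_def split: if_splits)
  then show ?case using Quant.IH[of g'] by (simp add: leaf_completion_def)
next
  case (Conn c l r)
  then obtain g' where "g = 0 # g' \<and> is_path (map_tree (\<lambda>_. ()) l) g' \<or> g = 1 # g' \<and> is_path (map_tree (\<lambda>_. ()) r) g'"
    by (cases g) (auto simp: is_path_def split: if_splits)
  then show ?case using Conn.IH[of g'] by (auto simp: leaf_completion_def)
qed

lemma first_order_map [simp]: "first_order_tree (map_tree f S) = first_order_tree S"
  by (induction S) auto

theorem mainTheorem8: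
  fixes T :: pi_tree
  assumes "regular_tree T"
    and "no_conjunctions T"
    and "\<not> GH2 T"
    and "\<not> coordinated T"
    and "\<not> henkin T"
    and "\<not> signalling T"
  shows "(\<exists>T' :: pi_tree. first_order_tree T' \<and> reduces_to T T') \<and> in_FO T"
proof -
  have nr: "no_requantification T" using assms(1) by (simp add: regular_tree_def)
  let ?t = "dtree_of T T []"
  have root: "subtree_at T [] = Some T" "univs_above T [] = {}" by (simp_all add: univs_above_def)
  have wf: "wf_dtree {} ?t" using wf_dtree_of[OF root(1)] root(2) by simp
  have tame: "tame {} {} ?t" using tame_dtree_of[OF assms(2-6) root(1)] root(2) by simp
  \<comment> \<open>\<open>S\<close> is fixed before any completion is considered, which makes the
    tree \<open>T'\<close> below depend on \<open>T\<close> alone.\<close>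
  obtain S where S: "first_order_tree S" "set_tree S \<subseteq> leaves ?t"
    "\<And>(C :: nat set) P s. C \<noteq> {} \<Longrightarrow> leaf_insens (bound ?t) ?t P \<Longrightarrow> fo_eval C P S s = skolem_sat C P ?t s"
    using first_order_reading[OF wf _ tame, where 'a = nat] by auto
  have "finite (bound ?t)" by (simp add: bound_def finite_univs finite_exs)
  then obtain ns where ns: "set ns = bound ?t" using finite_list by blast
  let ?S = "close ns S"
  define T' where "T' = map_tree (\<lambda>_. ()) ?S"
  have fo: "first_order_tree T'" by (simp add: T'_def first_order_close S(1))
  have "reduces_to T T'"
    unfolding reduces_to_def
  proof
    fix K assume "K \<in> model_classes T"
    then obtain \<sigma> e where e: "completing \<sigma> T e" "weak T e" "sentential T e"
      and K: "K = {M. finite_structure \<sigma> M \<and> models M (completion T e)}"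
      unfolding model_classes_def by blast
    \<comment> \<open>The formulas must speak about addresses, the variables of the new tree. Since
      \<open>e\<close> is sentential, each variable free in \<open>e g\<close> has a binder above
      \<open>g\<close>, so \<open>the\<close> is applied only to defined values where it
      matters.\<close>
    define f where "f g = map_tree (ren_literal (\<lambda>v. to_nat (the (binding_addr T g v)))) (e g)" for g
    let ?e = "leaf_completion f ?S"
    have path: "is_path T g" if "g \<in> set_tree ?S" for g
      using that S(2) leaves_dtree_of[OF root(1)] by (auto simp: set_close)
    have e': "\<exists>g. is_path T g \<and> ?e g' = f g" if "is_path T' g'" for g'
      using leaf_completion_path[of ?S g' f] that path unfolding T'_def by blast
    have qf: "quantifier_free (e g)" if "is_path T g" for g
      using e(2) that by (simp add: weak_def)
    have bindings: "\<exists>q. binding_addr T g v = Some q \<and> to_nat q \<in> bound ?t"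
      if g: "is_path T g" and v: "v \<in> free_vars literal_vars (e g)" for g v
    proof -
      have "v \<in> path_bound T g" using e(3) g v by (auto simp: sentential_def)
      then obtain q Q V where q: "prefix q g" "quant_at T q Q v V" by (auto simp: path_bound_def)
      have "q \<noteq> g" using q(2) g by (auto simp: is_path_def quant_at_def)
      then have "binding_addr T g v = Some q"
        using binder_eq[OF nr _ q(2)] q(1) by (simp add: strict_prefix_def)
      then show ?thesis using bound_dtree_of_quant[OF q(2), where T = T and p = "[]"] by simp
    qed
    have "completing \<sigma> T' ?e"
      unfolding completing_def
    proof (intro allI impI)
      fix g' assume "is_path T' g'"
      then obtain g where "is_path T g" "?e g' = f g" using e' by blast
      then show "regular_formula (?e g') \<and> formula_over \<sigma> (?e g')"
        using e(1) qf by (simp add: f_def completing_def regular_if_quantifier_free formula_over_ren)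
    qed
    moreover have weak': "weak T' ?e"
      unfolding weak_def using e' qf by (fastforce simp: f_def)
    moreover have sent: "sentential T' ?e"
      unfolding sentential_def
    proof (intro allI impI)
      fix g' assume g': "is_path T' g'"
      then obtain g where g: "is_path T g" "?e g' = f g" using e' by blast
      have "free_vars literal_vars (f g) \<subseteq> bound ?t"
        using bindings[OF g(1)] qf[OF g(1)] by (fastforce simp: f_def free_vars_ren)
      then show "free_vars literal_vars (?e g') \<subseteq> path_bound T' g'"
        using path_bound_close[of ns S g'] g' g(2) ns unfolding T'_def by simp
    qed
    moreover have "models M (completion T' ?e) \<longleftrightarrow> models M (completion T e)"
      if "finite_structure \<sigma> M" for M :: "nat struc"
    proof -
      have C: "carrier M \<noteq> {}" using that by (simp add: finite_structure_def)
      \<comment> \<open>Any state would do, and 0 need not even belong to the carrier: the completed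
        sentence is closed, and the Skolem statement at the root has the same truth value in all
        states.\<close>
      let ?P = "leaf_pred M T e" and ?\<tau> = "\<lambda>_. 0 :: nat"
      have li: "leaf_insens (bound ?t) ?t ?P"
        by (rule leaf_insens_leaf_pred[OF nr root(1)]) simp
      have foc: "first_order_tree (completion T' ?e)"
        by (rule first_order_completion[OF fo]) (use weak' in \<open>simp add: weak_def\<close>)
      have "free_vars literal_vars (completion T' ?e) \<subseteq> {}"
        by (rule free_vars_completion[OF fo]) (use sent in \<open>auto simp: sentential_def\<close>)
      then have closed: "fo_free (to_fo (completion T' ?e)) = {}" using fo_free_to_fo[OF foc] by simp
      have "models M (completion T' ?e) \<longleftrightarrow> fo_sat M Map.empty (to_fo (completion T' ?e))"
        by (simp add: models_def team_sat_first_order[OF foc])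
      also have "\<dots> \<longleftrightarrow> fo_sat M (\<lambda>x. Some (?\<tau> x)) (to_fo (completion T' ?e))"
        by (rule fo_sat_cong) (simp add: closed)
      also have "\<dots> \<longleftrightarrow> fo_eval (carrier M) (\<lambda>g \<tau>. fo_sat M (\<lambda>x. Some (\<tau> x)) (to_fo (f g))) ?S ?\<tau>"
        unfolding T'_def completion_leaf_completion by (rule fo_sat_graft)
      also have "\<dots> \<longleftrightarrow> fo_eval (carrier M) ?P ?S ?\<tau>"
      proof (rule fo_eval_cong)
        fix g assume "g \<in> set_tree ?S"
        then have g: "is_path T g" by (rule path)
        show "(\<lambda>\<tau>. fo_sat M (\<lambda>x. Some (\<tau> x)) (to_fo (f g))) = ?P g"
        proof
          fix \<tau> :: "nat \<Rightarrow> nat"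
          show "fo_sat M (\<lambda>x. Some (\<tau> x)) (to_fo (f g)) = ?P g \<tau>"
            unfolding f_def leaf_pred_def
            by (rule fo_sat_ren[OF qf[OF g]]) (use bindings[OF g] in \<open>force simp: asg_of_def\<close>)
        qed
      qed
      also have "\<dots> \<longleftrightarrow> fo_eval (carrier M) ?P S ?\<tau>"
      proof -
        \<comment> \<open>The quantifiers added by \<open>close\<close> are vacuous, because
          \<open>S\<close> expresses a Skolem statement that ignores all variables bound in its
          tree.\<close>
        have "insens (bound ?t) (skolem_sat (carrier M) ?P ?t)"
          by (rule insens_skolem_sat[OF li wf]) simp
        then have "insens (bound ?t) (fo_eval (carrier M) ?P S)"
          using S(3)[OF C li] by (simp add: insens_def)
        then show ?thesis using fo_eval_close[OF C, of "bound ?t" ?P S ns] ns by simp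
      qed
      also have "\<dots> \<longleftrightarrow> skolem_sat (carrier M) ?P ?t ?\<tau>" by (rule S(3)[OF C li])
      also have "\<dots> \<longleftrightarrow> models M (completion T e)"
        using models_completion_iff[OF nr assms(2,6) e(2) C] by simp
      finally show ?thesis .
    qed
    then have "K = {M. finite_structure \<sigma> M \<and> models M (completion T' ?e)}" unfolding K by blast
    ultimately show "K \<in> model_classes T'" unfolding model_classes_def by blast
  qed
  moreover have "in_FO T"
    using first_order_tree_in_FO[OF fo] calculation unfolding in_FO_def reduces_to_def by blast
  ultimately show ?thesis using fo by blast
qed

end
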